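(* Let $\mathcal{V}$ and $\mathcal{W}$ be two pointwise finite-dimensional weighted persistence modules over a field $\mathbb{K}$, with associated weighted barcodes $\mathcal{B}_{\mathcal{V}}$ and $\mathcal{B}_{\mathcal{W}}$, respectively. Then $$d_B(\mathcal{B}_{\mathcal{V}},\mathcal{B}_{\mathcal{W}})=d_I(\mathcal{V},\mathcal{W}),$$ where $d_B$ is the bottleneck distance of weighted barcodes and $d_I$ is the interleaving distance of weighted persistence modules.
   Context: A weighted vector space over a field $\mathbb{K}$ is a vector space graded over the non-negative reals, $V=\bigoplus_{w\in\mathbb{R}_{\ge 0}}V_w$. Morphisms of weighted vector spaces are $\mathbb{K}$-linear maps $f:V\to V'$ with $f(V_w)\subseteq V'_w$ for all $w$; the resulting category is $\mathbf{Vec}^{\ast}_{\mathbb{K}}$. A weighted persistence module is a functor $\mathcal{V}:(\mathbb{R},\le)\to\mathbf{Vec}^{\ast}_{\mathbb{K}}$; it is pointwise finite-dimensional if each $\mathcal{V}(r)$ is finite-dimensional. For $w\ge 0$, $\mathcal{V}_w:(\mathbb{R},\le)\to\mathbf{Vec}_{\mathbb{K}}$, $\mathcal{V}_w(r)=\mathcal{V}(r)_w$, is an ordinary persistence module. Weighted barcode: the multiset $\mathcal{B}_{\mathcal{V}}$ of triples $([b,d],w)$, where $w\in\mathbb{R}_{\ge0}$ is a weight and $[b,d]$ runs over the bars (with birth time $b$ and death time $d$, possibly infinite) of the barcode of the ordinary persistence module $\mathcal{V}_w$ (i.e. the intervals, recorded by their endpoints, in its decomposition into interval modules). Bottleneck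 distance: $d_B(\mathcal{B}_1,\mathcal{B}_2)$ is the infimum, over all matchings $\gamma$ between $\mathcal{B}_1$ and $\mathcal{B}_2$ that preserve weights (bars are only matched with bars of the same weight $w$), of the supremum of the following costs: a matched pair $([b_1,d_1],w)\mapsto([b_2,d_2],w)$ costs $\max(|b_1-b_2|,|d_1-d_2|)$ (equal infinite endpoints contribute $0$); an unmatched bar $([b,d],w)$ of $\mathcal{B}_1$ or $\mathcal{B}_2$ is paired with the diagonal point $([x,x],w)$, $x=(b+d)/2$, and costs $(d-b)/2$. Interleaving distance: for $x\in\mathbb{R}$, $(\Sigma^x\mathcal{V})(a)=\mathcal{V}(a+x)$; for $x\ge 0$ the structure maps of $\mathcal{V}$ give a natural transformation $\mathcal{V}\Rightarrow\Sigma^x\mathcal{V}$, also denoted $\Sigma^x$. $\mathcal{V}$ and $\mathcal{W}$ are $\varepsilon$-interleaved ($\varepsilon\ge 0$) if there are natural transformations (in $\mathbf{Vec}^{\ast}_{\mathbb{K}}$) $\phi:\mathcal{V}\Rightarrow\Sigma^\varepsilon\mathcal{W}$ and $\psi:\mathcal{W}\Rightarrow\Sigma^\varepsilon\mathcal{V}$ with $(\Sigma^\varepsilon\psi)\circ\phi=\Sigma^{2\varepsilon}$ and $(\Sigma^\varepsilon\phi)\circ\psi=\Sigma^{2\varepsilon}$. Then $d_I(\mathcal{V},\mathcal{W})=\inf\{\varepsilon\ge 0\mid \mathcal{V},\mathcal{W}\text{ are }\varepsilon\text{-interleaved}\}$ (with $\inf\emptyset=\infty$). *)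

theory Defs
  imports
    "HOL-Analysis.Analysis"
    "HOL-Library.Poly_Mapping"
    "HOL-Library.Extended_Nonnegative_Real"
begin

section \<open>Persistence modules\<close>

text \<open>
  A functor from the ordered set of reals to vector spaces over the field \<open>'k\<close>. All the
  spaces \<open>vsp M r\<close> are subspaces of one ambient vector space, the type \<open>'v\<close> with scalar
  multiplication \<open>scl M\<close>; up to isomorphism this is no restriction (embed the spaces in their
  direct sum), and no relation between the different \<open>vsp M r\<close> is imposed. The structure map
  \<open>tmap M r s\<close> is only meaningful for \<open>r \<le> s\<close> and on \<open>vsp M r\<close>.
\<close>

record ('k, 'v) pmod =
  scl :: "'k \<Rightarrow> 'v \<Rightarrow> 'v"
  vsp :: "real \<Rightarrow> 'v set"
  tmap :: "real \<Rightarrow> real \<Rightarrow> 'v \<Rightarrow> 'v"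

definition linear_between ::
  "('k::field \<Rightarrow> 'v::ab_group_add \<Rightarrow> 'v) \<Rightarrow> 'v set \<Rightarrow>
   ('k \<Rightarrow> 'w::ab_group_add \<Rightarrow> 'w) \<Rightarrow> 'w set \<Rightarrow> ('v \<Rightarrow> 'w) \<Rightarrow> bool" where
  "linear_between s S t T f \<longleftrightarrow>
     f ` S \<subseteq> T \<and>
     (\<forall>x\<in>S. \<forall>y\<in>S. f (x + y) = f x + f y) \<and>
     (\<forall>a. \<forall>x\<in>S. f (s a x) = t a (f x))"

definition persistence_module :: "('k::field, 'v::ab_group_add, 'z) pmod_scheme \<Rightarrow> bool" where
  "persistence_module M \<longleftrightarrow>
     vector_space (scl M) \<and>
     (\<forall>r. module.subspace (scl M) (vsp M r)) \<and>
     (\<forall>r s. r \<le> s \<longrightarrow> linear_between (scl M) (vsp M r) (scl M) (vsp M s) (tmap M r s)) \<and>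
     (\<forall>r. \<forall>x\<in>vsp M r. tmap M r r x = x) \<and>
     (\<forall>r s t. r \<le> s \<longrightarrow> s \<le> t \<longrightarrow> (\<forall>x\<in>vsp M r. tmap M s t (tmap M r s x) = tmap M r t x))"

definition pointwise_finite_dim :: "('k::field, 'v::ab_group_add, 'z) pmod_scheme \<Rightarrow> bool" where
  "pointwise_finite_dim M \<longleftrightarrow> (\<forall>r. \<exists>B. finite B \<and> vsp M r = module.span (scl M) B)"

definition nat_trans ::
  "('k::field, 'v::ab_group_add, 'z) pmod_scheme \<Rightarrow> ('k, 'w::ab_group_add, 'y) pmod_scheme \<Rightarrow>
   (real \<Rightarrow> 'v \<Rightarrow> 'w) \<Rightarrow> bool" where
  "nat_trans M N \<phi> \<longleftrightarrow>
     (\<forall>r. linear_between (scl M) (vsp M r) (scl N) (vsp N r) (\<phi> r)) \<and>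
     (\<forall>r s. r \<le> s \<longrightarrow> (\<forall>x\<in>vsp M r. \<phi> s (tmap M r s x) = tmap N r s (\<phi> r x)))"

definition pmod_isomorphic ::
  "('k::field, 'v::ab_group_add, 'z) pmod_scheme \<Rightarrow> ('k, 'w::ab_group_add, 'y) pmod_scheme \<Rightarrow>
   bool" where
  "pmod_isomorphic M N \<longleftrightarrow>
     (\<exists>\<phi>. nat_trans M N \<phi> \<and> (\<forall>r. bij_betw (\<phi> r) (vsp M r) (vsp N r)))"

section \<open>Interval modules and barcodes of ordinary persistence modules\<close>

definition interval_module :: "real set \<Rightarrow> ('k::field, 'k) pmod" where
  "interval_module J =
     \<lparr>scl = (*),
      vsp = (\<lambda>r. if r \<in> J then UNIV else {0}),
      tmap = (\<lambda>r s x. if r \<in> J \<and> s \<in> J then x else 0)\<rparr>"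

text \<open>The elements of a direct sum are the finitely supported families.\<close>

definition direct_sum ::
  "'i set \<Rightarrow> ('i \<Rightarrow> ('k::field, 'v::ab_group_add) pmod) \<Rightarrow> ('k, 'i \<Rightarrow>\<^sub>0 'v) pmod" where
  "direct_sum I M =
     \<lparr>scl = (\<lambda>a. Poly_Mapping.mapp (\<lambda>i. scl (M i) a)),
      vsp = (\<lambda>r. {c. Poly_Mapping.keys c \<subseteq> I \<and> (\<forall>i\<in>I. Poly_Mapping.lookup c i \<in> vsp (M i) r)}),
      tmap = (\<lambda>r s. Poly_Mapping.mapp (\<lambda>i. tmap (M i) r s))\<rparr>"

text \<open>
  Barcodes may be infinite, so they are not elements of the type \<open>multiset\<close>. A multiset with
  finite multiplicities is given by its multiplicity function \<open>m\<close>, and \<open>copies m\<close> is the set of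
  its members, in which an element of multiplicity \<open>n\<close> occurs \<open>n\<close> times. Multiplicities are
  finite for the barcodes of pointwise finite-dimensional modules.
\<close>

definition copies :: "('a \<Rightarrow> nat) \<Rightarrow> ('a \<times> nat) set" where
  "copies m = {(x, k). k < m x}"

definition interval_decomposition ::
  "('k::field, 'v::ab_group_add, 'z) pmod_scheme \<Rightarrow> (real set \<Rightarrow> nat) \<Rightarrow> bool" where
  "interval_decomposition M m \<longleftrightarrow>
     (\<forall>J. 0 < m J \<longrightarrow> is_interval J \<and> J \<noteq> {}) \<and>
     pmod_isomorphic M
       (direct_sum (copies m) (\<lambda>(J, k). interval_module J) :: ('k, real set \<times> nat \<Rightarrow>\<^sub>0 'k) pmod)"

definition birth :: "real set \<Rightarrow> ereal" where
  "birth J = Inf (ereal ` J)"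

definition death :: "real set \<Rightarrow> ereal" where
  "death J = Sup (ereal ` J)"

text \<open>
  Bars are recorded by their endpoints only, so that for instance the intervals from \<open>b\<close> to \<open>d\<close>
  with and without their endpoints all contribute to the multiplicity of \<open>(b, d)\<close>. There are at
  most four of them, so the cardinality below is that of a finite set.
\<close>

definition is_barcode ::
  "('k::field, 'v::ab_group_add, 'z) pmod_scheme \<Rightarrow> (ereal \<times> ereal \<Rightarrow> nat) \<Rightarrow> bool" where
  "is_barcode M \<beta> \<longleftrightarrow>
     (\<exists>m. interval_decomposition M m \<and>
          (\<forall>b d. \<beta> (b, d) = card {(J, k) \<in> copies m. birth J = b \<and> death J = d}))"

section \<open>Weighted persistence modules\<close>

text \<open>Only the graded pieces \<open>grade V r w\<close> with \<open>0 \<le> w\<close> are meaningful.\<close>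

record ('k, 'v) wpmod = "('k, 'v) pmod" +
  grade :: "real \<Rightarrow> real \<Rightarrow> 'v set"

text \<open>\<open>U\<close> is the internal direct sum of its subspaces \<open>G w\<close>, \<open>0 \<le> w\<close>.\<close>

definition weighted_vector_space ::
  "('k::field \<Rightarrow> 'v::ab_group_add \<Rightarrow> 'v) \<Rightarrow> 'v set \<Rightarrow> (real \<Rightarrow> 'v set) \<Rightarrow> bool" where
  "weighted_vector_space s U G \<longleftrightarrow>
     vector_space s \<and>
     module.subspace s U \<and>
     (\<forall>w\<ge>0. module.subspace s (G w) \<and> G w \<subseteq> U) \<and>
     (\<forall>u\<in>U. \<exists>!c. Poly_Mapping.keys c \<subseteq> {0..} \<and>
                  (\<forall>w\<ge>0. Poly_Mapping.lookup c w \<in> G w) \<and>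
                  u = (\<Sum>w\<in>Poly_Mapping.keys c. Poly_Mapping.lookup c w))"

definition weighted_persistence_module ::
  "('k::field, 'v::ab_group_add, 'z) wpmod_scheme \<Rightarrow> bool" where
  "weighted_persistence_module V \<longleftrightarrow>
     persistence_module V \<and>
     (\<forall>r. weighted_vector_space (scl V) (vsp V r) (grade V r)) \<and>
     (\<forall>r s. r \<le> s \<longrightarrow> (\<forall>w\<ge>0. tmap V r s ` grade V r w \<subseteq> grade V s w))"

definition weighted_nat_trans ::
  "('k::field, 'v::ab_group_add, 'z) wpmod_scheme \<Rightarrow> ('k, 'w::ab_group_add, 'y) wpmod_scheme \<Rightarrow>
   (real \<Rightarrow> 'v \<Rightarrow> 'w) \<Rightarrow> bool" where
  "weighted_nat_trans V W \<phi> \<longleftrightarrow>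
     nat_trans V W \<phi> \<and> (\<forall>r. \<forall>w\<ge>0. \<phi> r ` grade V r w \<subseteq> grade W r w)"

definition weight_component ::
  "('k, 'v, 'z) wpmod_scheme \<Rightarrow> real \<Rightarrow> ('k, 'v) pmod" where
  "weight_component V w = \<lparr>scl = scl V, vsp = (\<lambda>r. grade V r w), tmap = tmap V\<rparr>"

section \<open>Interleaving distance\<close>

definition shift :: "real \<Rightarrow> ('k, 'v, 'z) wpmod_scheme \<Rightarrow> ('k, 'v, 'z) wpmod_scheme" where
  "shift x V = V\<lparr>vsp := (\<lambda>a. vsp V (a + x)),
                 tmap := (\<lambda>a b. tmap V (a + x) (b + x)),
                 grade := (\<lambda>a. grade V (a + x))\<rparr>"

definition interleaved ::
  "real \<Rightarrow> ('k::field, 'v::ab_group_add, 'z) wpmod_scheme \<Rightarrow>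
   ('k, 'w::ab_group_add, 'y) wpmod_scheme \<Rightarrow> bool" where
  "interleaved \<epsilon> V W \<longleftrightarrow>
     (\<exists>\<phi> \<psi>. weighted_nat_trans V (shift \<epsilon> W) \<phi> \<and>
            weighted_nat_trans W (shift \<epsilon> V) \<psi> \<and>
            (\<forall>a. \<forall>x\<in>vsp V a. \<psi> (a + \<epsilon>) (\<phi> a x) = tmap V a (a + 2 * \<epsilon>) x) \<and>
            (\<forall>a. \<forall>y\<in>vsp W a. \<phi> (a + \<epsilon>) (\<psi> a y) = tmap W a (a + 2 * \<epsilon>) y))"

definition interleaving_distance ::
  "('k::field, 'v::ab_group_add, 'z) wpmod_scheme \<Rightarrow>
   ('k, 'w::ab_group_add, 'y) wpmod_scheme \<Rightarrow> ennreal" where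
  "interleaving_distance V W = (INF \<epsilon>\<in>{\<epsilon>. 0 \<le> \<epsilon> \<and> interleaved \<epsilon> V W}. ennreal \<epsilon>)"

section \<open>Weighted barcodes and bottleneck distance\<close>

text \<open>A bar from \<open>b\<close> to \<open>d\<close> of weight \<open>w\<close> is the triple \<open>((b, d), w)\<close>.\<close>

type_synonym wbar = "(ereal \<times> ereal) \<times> real"

definition is_weighted_barcode ::
  "('k::field, 'v::ab_group_add, 'z) wpmod_scheme \<Rightarrow> (wbar \<Rightarrow> nat) \<Rightarrow> bool" where
  "is_weighted_barcode V B \<longleftrightarrow>
     (\<forall>w\<ge>0. is_barcode (weight_component V w) (\<lambda>bd. B (bd, w))) \<and>
     (\<forall>w<0. \<forall>bd. B (bd, w) = 0)"

definition weighted_matching ::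
  "(wbar \<Rightarrow> nat) \<Rightarrow> (wbar \<Rightarrow> nat) \<Rightarrow> ((wbar \<times> nat) \<times> (wbar \<times> nat)) set \<Rightarrow> bool" where
  "weighted_matching B\<^sub>1 B\<^sub>2 \<gamma> \<longleftrightarrow>
     \<gamma> \<subseteq> copies B\<^sub>1 \<times> copies B\<^sub>2 \<and>
     single_valued \<gamma> \<and> single_valued (\<gamma>\<inverse>) \<and>
     (\<forall>(p, q)\<in>\<gamma>. snd (fst p) = snd (fst q))"

text \<open>In \<open>ereal\<close>, \<open>\<infinity> - \<infinity> = \<infinity>\<close>, hence the case distinction for equal infinite endpoints.\<close>

definition endpoint_cost :: "ereal \<Rightarrow> ereal \<Rightarrow> ennreal" where
  "endpoint_cost x y = (if x = y then 0 else e2ennreal \<bar>x - y\<bar>)"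

fun matched_cost :: "wbar \<Rightarrow> wbar \<Rightarrow> ennreal" where
  "matched_cost ((b\<^sub>1, d\<^sub>1), w\<^sub>1) ((b\<^sub>2, d\<^sub>2), w\<^sub>2) =
     max (endpoint_cost b\<^sub>1 b\<^sub>2) (endpoint_cost d\<^sub>1 d\<^sub>2)"

fun unmatched_cost :: "wbar \<Rightarrow> ennreal" where
  "unmatched_cost ((b, d), w) = e2ennreal ((d - b) / 2)"

definition matching_cost ::
  "(wbar \<Rightarrow> nat) \<Rightarrow> (wbar \<Rightarrow> nat) \<Rightarrow> ((wbar \<times> nat) \<times> (wbar \<times> nat)) set \<Rightarrow> ennreal" where
  "matching_cost B\<^sub>1 B\<^sub>2 \<gamma> =
     Sup ((\<lambda>(p, q). matched_cost (fst p) (fst q)) ` \<gamma> \<union>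
          (\<lambda>p. unmatched_cost (fst p)) ` (copies B\<^sub>1 - Domain \<gamma>) \<union>
          (\<lambda>q. unmatched_cost (fst q)) ` (copies B\<^sub>2 - Range \<gamma>))"

definition bottleneck_distance :: "(wbar \<Rightarrow> nat) \<Rightarrow> (wbar \<Rightarrow> nat) \<Rightarrow> ennreal" where
  "bottleneck_distance B\<^sub>1 B\<^sub>2 = (INF \<gamma>\<in>{\<gamma>. weighted_matching B\<^sub>1 B\<^sub>2 \<gamma>}. matching_cost B\<^sub>1 B\<^sub>2 \<gamma>)"

section \<open>Well-definedness checks\<close>

lemma persistence_module_weight_component:
  assumes V: "weighted_persistence_module V" and w: "0 \<le> w"
  shows "persistence_module (weight_component V w)"
proof -
  have pm: "persistence_module V"
    and gr: "\<And>r. weighted_vector_space (scl V) (vsp V r) (grade V r)"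
    and im: "\<And>r s. r \<le> s \<Longrightarrow> tmap V r s ` grade V r w \<subseteq> grade V s w"
    using V w unfolding weighted_persistence_module_def by auto
  have sub: "module.subspace (scl V) (grade V r w)" "grade V r w \<subseteq> vsp V r" for r
    using gr[of r] w unfolding weighted_vector_space_def by auto
  have lin: "linear_between (scl V) (grade V r w) (scl V) (grade V s w) (tmap V r s)" if "r \<le> s" for r s
  proof -
    have "linear_between (scl V) (vsp V r) (scl V) (vsp V s) (tmap V r s)"
      using pm that unfolding persistence_module_def by auto
    then show ?thesis
      using sub(2)[of r] im[OF that] unfolding linear_between_def by (meson subsetD)
  qed
  have "vector_space (scl V)" "\<And>r x. x \<in> grade V r w \<Longrightarrow> tmap V r r x = x"
    "\<And>r s t x. r \<le> s \<Longrightarrow> s \<le> t \<Longrightarrow> x \<in> grade V r w \<Longrightarrow> tmap V s t (tmap V r s x) = tmap V r t x"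
    using pm sub(2) unfolding persistence_module_def by (meson subsetD)+
  then show ?thesis
    unfolding persistence_module_def weight_component_def pmod.simps using sub(1) lin by auto
qed

lemma persistence_module_interval_module:
  assumes "is_interval J"
  shows "persistence_module (interval_module J :: ('k::field, 'k) pmod)"
proof -
  let ?M = "interval_module J :: ('k, 'k) pmod"
  have vs: "vector_space ((*) :: 'k \<Rightarrow> 'k \<Rightarrow> 'k)"
    by unfold_locales (simp_all add: algebra_simps)
  have sub: "module.subspace ((*) :: 'k \<Rightarrow> 'k \<Rightarrow> 'k) UNIV" "module.subspace ((*) :: 'k \<Rightarrow> 'k \<Rightarrow> 'k) {0}"
    using vs by (simp_all add: module.subspace_def module_iff_vector_space)
  have mid: "s \<in> J" if "r \<in> J" "t \<in> J" "r \<le> s" "s \<le> t" for r s t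
    using assms that unfolding is_interval_1 by blast
  have lin: "linear_between (scl ?M) (vsp ?M r) (scl ?M) (vsp ?M s) (tmap ?M r s)" for r s
    by (simp add: linear_between_def interval_module_def image_subset_iff)
  have comp: "tmap ?M s t (tmap ?M r s x) = tmap ?M r t x"
    if "r \<le> s" "s \<le> t" "x \<in> vsp ?M r" for r s t x
    using that mid[of r t s] by (simp add: interval_module_def)
  have "vector_space (scl ?M)" "module.subspace (scl ?M) (vsp ?M r)"
    "x \<in> vsp ?M r \<Longrightarrow> tmap ?M r r x = x" for r x
    using vs sub by (simp_all add: interval_module_def split: if_splits)
  then show ?thesis
    unfolding persistence_module_def using lin comp by blast
qed

lemma persistence_module_direct_sum:
  fixes M :: "'i \<Rightarrow> ('k::field, 'v::ab_group_add) pmod"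
  assumes vs: "\<And>i. vector_space (scl (M i))"
    and pm: "\<And>i. i \<in> I \<Longrightarrow> persistence_module (M i)"
  shows "persistence_module (direct_sum I M)"
proof -
  note md = vs[folded module_iff_vector_space]
  note sclz = module.scale_zero_right[OF md]
  have lookup_scl: "Poly_Mapping.lookup (scl (direct_sum I M) a c) i = scl (M i) a (Poly_Mapping.lookup c i)"
    for a c i
    by (simp add: direct_sum_def mapp.rep_eq when_def in_keys_iff sclz)
  have vsD: "vector_space (scl (direct_sum I M))"
  proof
    show "scl (direct_sum I M) a (x + y) = scl (direct_sum I M) a x + scl (direct_sum I M) a y" for a x y
      by (rule poly_mapping_eqI)
        (simp add: lookup_scl lookup_add module.scale_right_distrib[OF md])
    show "scl (direct_sum I M) (a + b) x = scl (direct_sum I M) a x + scl (direct_sum I M) b x" for a b x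
      by (rule poly_mapping_eqI)
        (simp add: lookup_scl lookup_add module.scale_left_distrib[OF md])
    show "scl (direct_sum I M) a (scl (direct_sum I M) b x) = scl (direct_sum I M) (a * b) x" for a b x
      by (rule poly_mapping_eqI)
        (simp add: lookup_scl module.scale_scale[OF md])
    show "scl (direct_sum I M) 1 x = x" for x
      by (rule poly_mapping_eqI)
        (simp add: lookup_scl module.scale_one[OF md])
  qed
  note mdD = vsD[folded module_iff_vector_space]
  have sub: "module.subspace (scl (M i)) (vsp (M i) r)" if "i \<in> I" for i r
    using pm[OF that] by (simp add: persistence_module_def)
  have zero: "0 \<in> vsp (M i) r" if "i \<in> I" for i r
    using sub[OF that, of r] module.subspace_0[OF md] by blast
  have add: "x + y \<in> vsp (M i) r" if "i \<in> I" "x \<in> vsp (M i) r" "y \<in> vsp (M i) r" for i r x y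
    using sub[OF that(1), of r] that module.subspace_add[OF md] by blast
  have scale: "scl (M i) a x \<in> vsp (M i) r" if "i \<in> I" "x \<in> vsp (M i) r" for i r x a
    using sub[OF that(1), of r] that module.subspace_scale[OF md] by blast
  have lin: "linear_between (scl (M i)) (vsp (M i) r) (scl (M i)) (vsp (M i) s) (tmap (M i) r s)"
    if "i \<in> I" "r \<le> s" for i r s
    using pm[OF that(1)] that(2) by (simp add: persistence_module_def)
  have tmap_zero: "tmap (M i) r s 0 = 0" if "i \<in> I" "r \<le> s" for i r s
  proof -
    have "tmap (M i) r s (0 + 0) = tmap (M i) r s 0 + tmap (M i) r s 0"
      using lin[OF that] zero[OF that(1), of r] unfolding linear_between_def by blast
    then show ?thesis by simp
  qed
  have mem: "c \<in> vsp (direct_sum I M) r \<longleftrightarrow>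
      (\<forall>i. if i \<in> I then Poly_Mapping.lookup c i \<in> vsp (M i) r else Poly_Mapping.lookup c i = 0)" for c r
    by (auto simp: direct_sum_def in_keys_iff subset_iff)
  have lookup_tmap: "Poly_Mapping.lookup (tmap (direct_sum I M) r s c) i =
      (if i \<in> I then tmap (M i) r s (Poly_Mapping.lookup c i) else 0)"
    if "c \<in> vsp (direct_sum I M) r" "r \<le> s" for r s c i
    using that(1) tmap_zero[OF _ that(2)] unfolding mem
    by (auto simp: direct_sum_def mapp.rep_eq when_def in_keys_iff split: if_splits)
  have lookup_mem: "Poly_Mapping.lookup x i \<in> vsp (M i) r"
    if "x \<in> vsp (direct_sum I M) r" "i \<in> I" for x r i
    using that unfolding mem by meson
  have lookup_0: "Poly_Mapping.lookup x i = 0"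
    if "x \<in> vsp (direct_sum I M) r" "i \<notin> I" for x r i
    using that unfolding mem by meson
  have D_sub: "module.subspace (scl (direct_sum I M)) (vsp (direct_sum I M) r)" for r
    unfolding module.subspace_def[OF mdD]
    by (auto simp: mem[of 0] mem[of "_ + _"] mem[of "scl _ _ _"] lookup_mem lookup_0
        lookup_add lookup_scl zero add scale sclz)
  have D_add: "x + y \<in> vsp (direct_sum I M) r"
    if "x \<in> vsp (direct_sum I M) r" "y \<in> vsp (direct_sum I M) r" for x y r
    using D_sub that module.subspace_add[OF mdD] by blast
  have D_scale: "scl (direct_sum I M) a x \<in> vsp (direct_sum I M) r"
    if "x \<in> vsp (direct_sum I M) r" for a x r
    using D_sub that module.subspace_scale[OF mdD] by blast
  have D_tmap: "tmap (direct_sum I M) r s x \<in> vsp (direct_sum I M) s"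
    if "x \<in> vsp (direct_sum I M) r" "r \<le> s" for x r s
    using lin[OF _ that(2)] lookup_mem[OF that(1)]
    by (force simp: mem[of "tmap _ _ _ _"] lookup_tmap[OF that] linear_between_def)
  have D_lin: "linear_between (scl (direct_sum I M)) (vsp (direct_sum I M) r)
      (scl (direct_sum I M)) (vsp (direct_sum I M) s) (tmap (direct_sum I M) r s)" if "r \<le> s" for r s
    unfolding linear_between_def
  proof (intro conjI ballI allI)
    show "tmap (direct_sum I M) r s ` vsp (direct_sum I M) r \<subseteq> vsp (direct_sum I M) s"
      using D_tmap that by blast
  next
    fix x y assume x: "x \<in> vsp (direct_sum I M) r" and y: "y \<in> vsp (direct_sum I M) r"
    show "tmap (direct_sum I M) r s (x + y) = tmap (direct_sum I M) r s x + tmap (direct_sum I M) r s y"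
      using lin[OF _ that] lookup_mem[OF x] lookup_mem[OF y]
      by (intro poly_mapping_eqI)
        (simp add: lookup_tmap[OF x that] lookup_tmap[OF y that] lookup_tmap[OF D_add[OF x y] that]
          lookup_add linear_between_def)
  next
    fix a x assume x: "x \<in> vsp (direct_sum I M) r"
    show "tmap (direct_sum I M) r s (scl (direct_sum I M) a x) =
        scl (direct_sum I M) a (tmap (direct_sum I M) r s x)"
      using lin[OF _ that] lookup_mem[OF x]
      by (intro poly_mapping_eqI)
        (simp add: lookup_tmap[OF x that] lookup_tmap[OF D_scale[OF x] that] lookup_scl sclz
          linear_between_def)
  qed
  have D_id: "tmap (direct_sum I M) r r x = x" if x: "x \<in> vsp (direct_sum I M) r" for x r
  proof (rule poly_mapping_eqI)
    fix i
    show "Poly_Mapping.lookup (tmap (direct_sum I M) r r x) i = Poly_Mapping.lookup x i"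
      using pm[of i] x lookup_mem[OF x, of i] unfolding lookup_tmap[OF x order_refl]
      by (auto simp: persistence_module_def mem split: if_splits)
  qed
  have D_comp: "tmap (direct_sum I M) s t (tmap (direct_sum I M) r s x) = tmap (direct_sum I M) r t x"
    if x: "x \<in> vsp (direct_sum I M) r" and rs: "r \<le> s" and st: "s \<le> t" for x r s t
  proof (rule poly_mapping_eqI)
    fix i
    show "Poly_Mapping.lookup (tmap (direct_sum I M) s t (tmap (direct_sum I M) r s x)) i =
        Poly_Mapping.lookup (tmap (direct_sum I M) r t x) i"
      using pm[of i] lookup_mem[OF x, of i] rs st
      unfolding lookup_tmap[OF D_tmap[OF x rs] st] lookup_tmap[OF x rs]
        lookup_tmap[OF x order_trans[OF rs st]]
      by (simp add: persistence_module_def)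
  qed
  show ?thesis
    unfolding persistence_module_def using vsD D_sub D_lin D_id D_comp by blast
qed

corollary persistence_module_interval_sum:
  assumes "\<And>J. 0 < m J \<Longrightarrow> is_interval J"
  shows "persistence_module
    (direct_sum (copies m) (\<lambda>(J, k). interval_module J) :: ('k::field, real set \<times> nat \<Rightarrow>\<^sub>0 'k) pmod)"
proof (rule persistence_module_direct_sum)
  have vs: "vector_space ((*) :: 'k \<Rightarrow> 'k \<Rightarrow> 'k)"
    by unfold_locales (simp_all add: algebra_simps)
  show "vector_space (scl ((case i of (J, k) \<Rightarrow> interval_module J) :: ('k, 'k) pmod))"
    for i :: "real set \<times> nat"
    using vs by (simp add: interval_module_def split: prod.split)
  show "persistence_module ((case i of (J, k) \<Rightarrow> interval_module J) :: ('k, 'k) pmod)"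
    if "i \<in> copies m" for i
  proof -
    have "is_interval (fst i)"
      using that by (intro assms) (auto simp: copies_def)
    then show ?thesis
      using persistence_module_interval_module by (auto split: prod.split)
  qed
qed

end

theory Submission
  imports Defs
begin

text \<open>
  Both distances are compared through a basis adapted to the barcode, in which the structure maps
  are diagonal.

  A matching of cost \<open>\<delta>\<close> gives an \<open>\<epsilon>\<close>-interleaving for every \<open>\<epsilon> > \<delta>\<close>, by sending basis elements to the
  basis elements of matched bars. Conversely (following Bjerkevik), an \<open>\<epsilon>\<close>-interleaving is given by
  two matrices of scalars. Consider finitely many bars of length more than \<open>2 * \<epsilon>\<close>, sorted by the
  sum of their endpoints. If a bar \<open>j\<close> mediates between a bar \<open>k\<close> and a later bar \<open>l\<close>, it is
  \<open>\<epsilon>\<close>-close to \<open>k\<close> or to \<open>l\<close>. So the product of the two matrices, restricted to the \<open>\<epsilon>\<close>-close bars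
  in the middle, is triangular with unit diagonal, and there are at least as many such bars as given
  ones: this is Hall's condition. The two injections of long bars obtained in this way are combined
  as in the Schroeder-Bernstein theorem.
\<close>

text \<open>Bars record endpoints, not whether they are attained. The interval modules on [0,1] and
  on the open interval from 0 to 1 have the same bar but are not 0-interleaved, so a matching of
  cost \<delta> need not give a \<delta>-interleaving; the infimum absorbs the strict \<epsilon> >
  \<delta>. The converse direction loses nothing: a bar of length strictly more than 2 * \<epsilon>
  has interior parameters t and t + 2 * \<epsilon>, where membership does not depend on the kind of
  endpoints.

  A barcode can be infinite even if every space is finite-dimensional, so Hall's theorem is needed
  for infinite families with finite sets of candidates. The candidates for one long bar are finitely
  many because they are all alive at one common parameter.\<close>

section \<open>Marriage theorem for infinite families\<close>

text \<open>Gaussian elimination: an equation \<open>y\<close> with \<open>a p y\<close> nonzero is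
  solved for the unknown \<open>p\<close> and substituted into the others. In
  \<open>matching_of_long_bars\<close> this turns a failure of Hall's condition into a linear
  dependence between rows.\<close>

lemma homogeneous_system_nontrivial_solution:
  fixes a :: "'i \<Rightarrow> 'j \<Rightarrow> 'k::field"
  assumes "finite Y" "finite X" "card Y < card X"
  shows "\<exists>x. (\<exists>i\<in>X. x i \<noteq> 0) \<and> (\<forall>j\<in>Y. (\<Sum>i\<in>X. x i * a i j) = 0)"
  using assms
proof (induction Y arbitrary: X a rule: finite_induct)
  case empty
  then obtain i where "i \<in> X" by fastforce
  then show ?case
    by (intro exI[of _ "\<lambda>k. if k = i then 1 else 0"]) auto
next
  case (insert y Y)
  show ?case
  proof (cases "\<forall>i\<in>X. a i y = 0")
    case True
    obtain x where "\<exists>i\<in>X. x i \<noteq> 0" "\<forall>j\<in>Y. (\<Sum>i\<in>X. x i * a i j) = 0"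
      using insert.IH[of X a] insert.prems insert.hyps by auto
    then show ?thesis using True by (intro exI[of _ x]) auto
  next
    case False
    then obtain p where p: "p \<in> X" "a p y \<noteq> 0" by auto
    define X' where "X' = X - {p}"
    have X': "finite X'" "card Y < card X'" "p \<notin> X'" "X = insert p X'"
      using insert.prems insert.hyps p(1) by (auto simp: X'_def)
    obtain x where x: "\<exists>i\<in>X'. x i \<noteq> 0"
      "\<forall>j\<in>Y. (\<Sum>i\<in>X'. x i * (a i j - a i y / a p y * a p j)) = 0"
      using insert.IH[OF X'(1,2), of "\<lambda>i j. a i j - a i y / a p y * a p j"] by blast
    define z where "z = (\<lambda>i. if i = p then - (\<Sum>i\<in>X'. x i * a i y) / a p y else x i)"
    have sum_z: "(\<Sum>i\<in>X. z i * a i j) = (\<Sum>i\<in>X'. x i * (a i j - a i y / a p y * a p j))" for j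
    proof -
      have "(\<Sum>i\<in>X. z i * a i j) = z p * a p j + (\<Sum>i\<in>X'. x i * a i j)"
        using X' by (auto simp: z_def intro!: sum.cong)
      also have "z p * a p j = (\<Sum>i\<in>X'. - (x i * (a i y / a p y * a p j)))"
        by (simp add: z_def sum_negf sum_distrib_right sum_divide_distrib mult.assoc)
      finally show ?thesis
        by (simp add: sum.distrib[symmetric] algebra_simps)
    qed
    have "(\<Sum>i\<in>X. z i * a i y) = 0"
      unfolding sum_z using p(2) by simp
    moreover have "\<exists>i\<in>X. z i \<noteq> 0"
      using x X' by (auto simp: z_def)
    ultimately show ?thesis
      using x(2) by (intro exI[of _ z]) (simp add: sum_z)
  qed
qed

definition hall_condition :: "'i set \<Rightarrow> ('i \<Rightarrow> 'j set) \<Rightarrow> bool" where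
  "hall_condition X S \<longleftrightarrow> (\<forall>A\<subseteq>X. finite A \<longrightarrow> card A \<le> card (\<Union>i\<in>A. S i))"

text \<open>The sets \<open>S i\<close> are finite, so the infimum of a chain is attained at each
  single index, and by comparability one member of the chain attains it at all indices of a finite
  \<open>A\<close>. Hall's condition only looks at finite \<open>A\<close>.\<close>

lemma hall_condition_Inf_chain:
  assumes chain: "\<And>S T. S \<in> \<C> \<Longrightarrow> T \<in> \<C> \<Longrightarrow> S \<le> T \<or> T \<le> S" and ne: "\<C> \<noteq> {}"
    and hall: "\<And>S. S \<in> \<C> \<Longrightarrow> hall_condition X S"
    and fin: "\<And>S i. S \<in> \<C> \<Longrightarrow> i \<in> X \<Longrightarrow> finite (S i)"
  shows "hall_condition X (Inf \<C>)"
  unfolding hall_condition_def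
proof (intro allI impI)
  fix A assume A: "A \<subseteq> X" "finite A"
  have "\<exists>S\<in>\<C>. \<forall>i\<in>A. S i = Inf \<C> i"
    using A(2,1)
  proof (induction A rule: finite_induct)
    case empty
    then show ?case using ne by auto
  next
    case (insert a A)
    then obtain S where S: "S \<in> \<C>" "\<forall>i\<in>A. S i = Inf \<C> i" by auto
    have "\<exists>T\<in>\<C>. T a = Inf \<C> a"
    proof -
      obtain T where T: "T \<in> \<C>" "\<And>U. U \<in> \<C> \<Longrightarrow> card (T a) \<le> card (U a)"
        using exists_least_iff[of "\<lambda>n. \<exists>T\<in>\<C>. card (T a) = n"] ne by (metis ex_in_conv not_le)
      have "T a \<subseteq> U a" if "U \<in> \<C>" for U
      proof (rule ccontr)
        assume *: "\<not> T a \<subseteq> U a"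
        then have "U \<le> T" using chain[OF T(1) that] by (auto simp: le_fun_def)
        then have "U a \<subset> T a" using * by (auto simp: le_fun_def)
        then have "card (U a) < card (T a)"
          using fin[OF T(1), of a] insert.prems psubset_card_mono by blast
        then show False using T(2)[OF that] by simp
      qed
      then have "T a = Inf \<C> a" using T(1) by (auto simp: Inf_apply)
      then show ?thesis using T(1) by blast
    qed
    then obtain T where T: "T \<in> \<C>" "T a = Inf \<C> a" by blast
    have le: "Inf \<C> \<le> S" "Inf \<C> \<le> T" using S(1) T(1) by (auto intro: Inf_lower)
    from chain[OF S(1) T(1)] show ?case
    proof
      assume "S \<le> T"
      then have "S a = Inf \<C> a" using le T by (metis le_fun_def order_antisym)
      then show ?thesis using S by auto
    next
      assume "T \<le> S"
      then have "\<forall>i\<in>A. T i = Inf \<C> i" using le S by (metis le_fun_def order_antisym)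
      then show ?thesis using T by auto
    qed
  qed
  then obtain S where S: "S \<in> \<C>" "\<forall>i\<in>A. S i = Inf \<C> i" by blast
  have "card A \<le> card (\<Union>i\<in>A. S i)"
    using hall[OF S(1)] A unfolding hall_condition_def by blast
  then show "card A \<le> card (\<Union>i\<in>A. Inf \<C> i)" using S(2) by simp
qed

text \<open>
  Rado's argument: a minimal family with Hall's condition consists of singletons. If \<open>S i\<close>
  contained \<open>x \<noteq> y\<close>, the violations caused by deleting \<open>x\<close> and by deleting \<open>y\<close> would contradict
  the submodularity of \<open>A \<mapsto> card (\<Union> (S ` A))\<close>.
\<close>

lemma hall_condition_minimal_singleton:
  assumes hall: "hall_condition X S" and fin: "\<And>i. i \<in> X \<Longrightarrow> finite (S i)"
    and minimal: "\<And>T. hall_condition X T \<Longrightarrow> T \<le> S \<Longrightarrow> T = S"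
    and i: "i \<in> X"
  shows "\<exists>x. S i = {x}"
proof (rule ccontr)
  assume not_single: "\<nexists>x. S i = {x}"
  have "card {i} \<le> card (\<Union>k\<in>{i}. S k)"
    using hall i unfolding hall_condition_def by blast
  then have "S i \<noteq> {}" by auto
  then obtain x y where xy: "x \<in> S i" "y \<in> S i" "x \<noteq> y" using not_single by blast
  \<comment> \<open>The violating set contains \<open>i\<close>, since otherwise deleting
    \<open>z\<close> changes nothing. Dropping \<open>i\<close> lowers its cardinality by one, which
    turns the strict inequality into \<open>\<le>\<close>.\<close>
  have violation: "\<exists>F\<subseteq>X - {i}. finite F \<and> card ((\<Union>k\<in>F. S k) \<union> (S i - {z})) \<le> card F"
    if z: "z \<in> S i" for z
  proof -
    define T where "T = S(i := S i - {z})"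
    have "T \<le> S" "T \<noteq> S" using z by (auto simp: T_def le_fun_def fun_eq_iff)
    then have "\<not> hall_condition X T" using minimal by blast
    then obtain A where A: "A \<subseteq> X" "finite A" "card (\<Union>k\<in>A. T k) < card A"
      unfolding hall_condition_def not_all not_imp not_le by blast
    have iA: "i \<in> A"
    proof (rule ccontr)
      assume "i \<notin> A"
      then have "(\<Union>k\<in>A. T k) = (\<Union>k\<in>A. S k)" by (auto simp: T_def)
      then have "card A \<le> card (\<Union>k\<in>A. T k)"
        using A(1,2) hall unfolding hall_condition_def by simp
      then show False using A(3) by simp
    qed
    have eq: "(\<Union>k\<in>A. T k) = (\<Union>k\<in>A - {i}. S k) \<union> (S i - {z})"
      using iA by (auto simp: T_def split: if_splits)
    show ?thesis
      using A iA unfolding eq by (intro exI[of _ "A - {i}"]) auto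
  qed
  obtain F where F: "F \<subseteq> X - {i}" "finite F" "card ((\<Union>k\<in>F. S k) \<union> (S i - {x})) \<le> card F"
    using violation[OF xy(1)] by blast
  obtain G where G: "G \<subseteq> X - {i}" "finite G" "card ((\<Union>k\<in>G. S k) \<union> (S i - {y})) \<le> card G"
    using violation[OF xy(2)] by blast
  let ?P = "(\<Union>k\<in>F. S k) \<union> (S i - {x})" and ?Q = "(\<Union>k\<in>G. S k) \<union> (S i - {y})"
  have finPQ: "finite ?P" "finite ?Q"
    using F G fin i by auto
  have "card (insert i (F \<union> G)) \<le> card (\<Union>k\<in>insert i (F \<union> G). S k)"
    using F(1,2) G(1,2) i by (intro hall[unfolded hall_condition_def, rule_format]) auto
  \<comment> \<open>As \<open>x \<noteq> y\<close>, each of the two deleted points survives in the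
    other set.\<close>
  also have "(\<Union>k\<in>insert i (F \<union> G). S k) = ?P \<union> ?Q" using xy by auto
  finally have 1: "Suc (card (F \<union> G)) \<le> card (?P \<union> ?Q)"
    using F(1,2) G(1,2) by (subst (asm) card_insert_disjoint) auto
  have "card (F \<inter> G) \<le> card (\<Union>k\<in>F \<inter> G. S k)"
    using F(1,2) G(1,2) by (intro hall[unfolded hall_condition_def, rule_format]) auto
  also have "\<dots> \<le> card (?P \<inter> ?Q)"
    using finPQ by (intro card_mono) auto
  finally have 2: "card (F \<inter> G) \<le> card (?P \<inter> ?Q)" .
  show False
    using 1 2 F(3) G(3) card_Un_Int[OF F(2) G(2)] card_Un_Int[OF finPQ(1) finPQ(2)] by linarith
qed

text \<open>Zorn's lemma for the reversed order gives a minimal family below \<open>S\<close> with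
  Hall's condition. Its sets are singletons, and their elements are distinct because Hall's
  condition for two indices asks for two elements.\<close>

theorem hall_infinite:
  assumes fin: "\<And>i. i \<in> X \<Longrightarrow> finite (S i)"
    and hall: "\<And>A. A \<subseteq> X \<Longrightarrow> finite A \<Longrightarrow> card A \<le> card (\<Union>i\<in>A. S i)"
  shows "\<exists>f. inj_on f X \<and> (\<forall>i\<in>X. f i \<in> S i)"
proof -
  define \<F> where "\<F> = {T. hall_condition X T \<and> T \<le> S}"
  have finT: "finite (T i)" if "T \<in> \<F>" "i \<in> X" for T i
    using that fin[of i] finite_subset[of "T i" "S i"] by (auto simp: \<F>_def le_fun_def)
  have S: "S \<in> \<F>" using hall by (simp add: \<F>_def hall_condition_def)
  have "\<exists>M\<in>\<F>. \<forall>T\<in>\<F>. T \<le> M \<longrightarrow> T = M"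
  proof (rule predicate_Zorn[where P = "\<lambda>x y. y \<le> x" and A = \<F>, simplified])
    show "partial_order_on \<F> (relation_of (\<lambda>x y. y \<le> x) \<F>)"
      by (rule partial_order_on_relation_ofI) auto
  next
    fix \<C> assume "\<C> \<in> Chains (relation_of (\<lambda>x y. y \<le> x) \<F>)"
    then have C: "\<C> \<subseteq> \<F>" "\<And>S T. S \<in> \<C> \<Longrightarrow> T \<in> \<C> \<Longrightarrow> S \<le> T \<or> T \<le> S"
      by (auto simp: Chains_def relation_of_def)
    show "\<exists>u\<in>\<F>. \<forall>a\<in>\<C>. u \<le> a"
    proof (cases "\<C> = {}")
      case True
      then show ?thesis using S by auto
    next
      case False
      have "hall_condition X (Inf \<C>)"
        using C False finT by (intro hall_condition_Inf_chain) (auto simp: \<F>_def)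
      moreover have "Inf \<C> \<le> S" using C(1) False by (auto simp: \<F>_def intro: Inf_lower2)
      ultimately show ?thesis
        by (intro bexI[of _ "Inf \<C>"]) (auto simp: \<F>_def intro: Inf_lower)
    qed
  qed
  then obtain M where M: "M \<in> \<F>" "\<And>T. T \<in> \<F> \<Longrightarrow> T \<le> M \<Longrightarrow> T = M" by blast
  have "\<forall>i\<in>X. \<exists>x. M i = {x}"
  proof (intro ballI, rule hall_condition_minimal_singleton[where S = M and X = X])
    show "hall_condition X M" using M(1) by (simp add: \<F>_def)
    show "finite (M i)" if "i \<in> X" for i using finT[OF M(1) that] .
    show "T = M" if "hall_condition X T" "T \<le> M" for T
      using that M(1) order_trans[of T M S] by (intro M(2)) (auto simp: \<F>_def)
  qed
  then obtain f where f: "\<And>i. i \<in> X \<Longrightarrow> M i = {f i}"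
    by (auto dest: bchoice)
  have "inj_on f X"
  proof (rule inj_onI, rule ccontr)
    fix i j assume ij: "i \<in> X" "j \<in> X" "f i = f j" "i \<noteq> j"
    have "hall_condition X M" using M(1) by (simp add: \<F>_def)
    then have "card {i, j} \<le> card (\<Union>k\<in>{i, j}. M k)"
      unfolding hall_condition_def using ij(1,2) by (elim allE[of _ "{i, j}"]) simp
    also have "(\<Union>k\<in>{i, j}. M k) = {f i}" using f[OF ij(1)] f[OF ij(2)] ij(3) by simp
    finally show False using ij(4) by simp
  qed
  moreover have "f i \<in> S i" if "i \<in> X" for i
    using f[OF that] M(1) by (auto simp: \<F>_def le_fun_def)
  ultimately show ?thesis by blast
qed

section \<open>Merging two injections into one matching\<close>

text \<open>A bar longer than \<open>2 * \<epsilon>\<close> may be close to a shorter one, so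
  \<open>f\<close> may leave \<open>B\<close> and \<open>g\<close> may leave \<open>A\<close>. Hence
  the intersections in the Schroeder-Bernstein construction, and a result that covers
  \<open>A\<close> and \<open>B\<close> but may involve further elements.\<close>

lemma combine_partial_injections:
  assumes f: "inj_on f A" and g: "inj_on g B"
  shows "\<exists>\<gamma>\<subseteq>{(x, f x) |x. x \<in> A} \<union> {(g y, y) |y. y \<in> B}.
    single_valued \<gamma> \<and> single_valued (\<gamma>\<inverse>) \<and> A \<subseteq> Domain \<gamma> \<and> B \<subseteq> Range \<gamma>"
proof -
  \<comment> \<open>The least fixed point collects the \<open>x\<close> that must use
    \<open>f\<close>: those that \<open>g\<close> does not reach, and those whose preimage under
    \<open>g\<close> is already taken by an \<open>f\<close>-edge.\<close>
  define F where "F = (\<lambda>S. (A - g ` B) \<union> (A \<inter> g ` (f ` S \<inter> B)))"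
  define S where "S = lfp F"
  have "mono F" by (auto simp: F_def mono_def)
  then have S: "S = (A - g ` B) \<union> (A \<inter> g ` (f ` S \<inter> B))"
    unfolding S_def by (subst lfp_unfold) (auto simp: F_def)
  then have S_iff: "x \<in> S \<longleftrightarrow> x \<in> (A - g ` B) \<union> (A \<inter> g ` (f ` S \<inter> B))" for x by blast
  then have SA: "S \<subseteq> A" by blast
  define \<gamma> where "\<gamma> = {(x, f x) |x. x \<in> S} \<union> {(g y, y) |y. y \<in> B - f ` S}"
  have disj: "g y \<notin> S" if "y \<in> B - f ` S" for y
  proof
    assume "g y \<in> S"
    then have "g y \<in> (A - g ` B) \<union> (A \<inter> g ` (f ` S \<inter> B))" using S_iff by blast
    then have "g y \<in> g ` (f ` S \<inter> B)" using that by blast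
    then obtain z where "z \<in> f ` S" "z \<in> B" "g y = g z" by auto
    then show False using that inj_onD[OF g, of y z] by auto
  qed
  show ?thesis
  proof (intro exI[of _ \<gamma>] conjI)
    show "\<gamma> \<subseteq> {(x, f x) |x. x \<in> A} \<union> {(g y, y) |y. y \<in> B}"
      using SA by (auto simp: \<gamma>_def)
    show "single_valued \<gamma>"
      using disj by (auto simp: \<gamma>_def single_valued_def dest: inj_onD[OF g])
    show "single_valued (\<gamma>\<inverse>)"
      using SA by (auto simp: \<gamma>_def single_valued_def dest: inj_onD[OF f])
    show "A \<subseteq> Domain \<gamma>"
    proof
      fix x assume x: "x \<in> A"
      show "x \<in> Domain \<gamma>"
      proof (cases "x \<in> S")
        case False
        then have "x \<notin> (A - g ` B) \<union> (A \<inter> g ` (f ` S \<inter> B))" using S_iff by blast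
        then obtain y where "y \<in> B" "x = g y" "y \<notin> f ` S" using x by blast
        then show ?thesis by (auto simp: \<gamma>_def)
      qed (auto simp: \<gamma>_def)
    qed
    show "B \<subseteq> Range \<gamma>"
    proof
      fix y assume "y \<in> B"
      then show "y \<in> Range \<gamma>" by (cases "y \<in> f ` S") (auto simp: \<gamma>_def)
    qed
  qed
qed

section \<open>Bars and Hall's condition\<close>

text \<open>The constraint that a nonzero morphism from the interval module of \<open>x\<close> to
  the \<epsilon>-shift of that of \<open>y\<close> puts on the endpoints. In both directions
  together it says that the bars are \<epsilon>-close.\<close>

definition bar_shift_le :: "real \<Rightarrow> ereal \<times> ereal \<Rightarrow> ereal \<times> ereal \<Rightarrow> bool" where
  "bar_shift_le \<epsilon> x y \<longleftrightarrow> fst y \<le> fst x + ereal \<epsilon> \<and> snd y \<le> snd x + ereal \<epsilon>"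

definition proper_bar :: "ereal \<times> ereal \<Rightarrow> bool" where
  "proper_bar x \<longleftrightarrow> fst x \<noteq> \<infinity> \<and> snd x \<noteq> -\<infinity>"

text \<open>
  The order of bars by the sum of their endpoints. Bars with infinite endpoints are first compared
  by \<open>bar_rank\<close>, which \<open>bar_shift_le\<close> never increases.
\<close>

definition bar_rank :: "ereal \<times> ereal \<Rightarrow> nat" where
  "bar_rank x = (if fst x = -\<infinity> then 0 else 1) + (if snd x = \<infinity> then 1 else 0)"

definition bar_pos :: "ereal \<times> ereal \<Rightarrow> real" where
  "bar_pos x = real_of_ereal (fst x) + real_of_ereal (snd x)"

definition bar_le :: "ereal \<times> ereal \<Rightarrow> ereal \<times> ereal \<Rightarrow> bool" where
  "bar_le x y \<longleftrightarrow> bar_rank x < bar_rank y \<or> bar_rank x = bar_rank y \<and> bar_pos x \<le> bar_pos y"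

text \<open>If \<open>y\<close> is close to neither, then from \<open>x\<close> to \<open>y\<close>
  one endpoint drops by more than \<epsilon> while the other rises by at most \<epsilon>, so the sum
  of the endpoints decreases; likewise from \<open>y\<close> to \<open>z\<close>. This contradicts
  \<open>bar_le x z\<close>. For infinite endpoints, the ranks along the chain must agree, so the
  same endpoints are infinite in all three bars.\<close>

lemma bar_shift_le_chain_close:
  assumes "proper_bar x" "proper_bar y" "proper_bar z"
    and "bar_shift_le \<epsilon> x y" "bar_shift_le \<epsilon> y z" "bar_le x z"
  shows "bar_shift_le \<epsilon> y x \<or> bar_shift_le \<epsilon> z y"
proof -
  obtain b1 d1 b2 d2 b3 d3 where [simp]: "x = (b1, d1)" "y = (b2, d2)" "z = (b3, d3)"
    by (metis surj_pair)
  show ?thesis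
    using assms unfolding proper_bar_def bar_shift_le_def bar_le_def bar_rank_def bar_pos_def
    by (cases b1; cases b2; cases b3; simp; cases d1; cases d2; cases d3; simp; linarith)
qed

text \<open>If \<open>z\<close> ended at or before \<open>fst x + 2 * \<epsilon>\<close>, both
  endpoints of \<open>z\<close> would lie below those of \<open>x\<close>, as both bars are long;
  this contradicts \<open>bar_le x z\<close>. With \<open>bar_shift_le_trans\<close> the conclusion
  provides a \<open>t\<close> inside \<open>x\<close> with \<open>t + 2 * \<epsilon>\<close> inside
  \<open>z\<close>.\<close>

lemma bar_shift_le_chain_overlap:
  assumes "proper_bar x" "proper_bar y" "proper_bar z"
    and "bar_shift_le \<epsilon> x y" "bar_shift_le \<epsilon> y z" "bar_le x z"
    and "fst x + ereal (2 * \<epsilon>) < snd x" "fst z + ereal (2 * \<epsilon>) < snd z"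
  shows "fst x + ereal (2 * \<epsilon>) < snd z"
proof -
  obtain b1 d1 b2 d2 b3 d3 where [simp]: "x = (b1, d1)" "y = (b2, d2)" "z = (b3, d3)"
    by (metis surj_pair)
  show ?thesis
    using assms unfolding proper_bar_def bar_shift_le_def bar_le_def bar_rank_def bar_pos_def
    by (cases b1; cases b2; cases b3; simp; cases d1; cases d2; cases d3; simp; linarith)
qed

lemma bar_shift_le_trans:
  assumes "bar_shift_le \<epsilon> x y" "bar_shift_le \<epsilon> y z"
  shows "bar_shift_le (2 * \<epsilon>) x z"
proof -
  obtain b1 d1 b2 d2 b3 d3 where [simp]: "x = (b1, d1)" "y = (b2, d2)" "z = (b3, d3)"
    by (metis surj_pair)
  show ?thesis
    using assms unfolding bar_shift_le_def
    by (cases b1; cases b2; cases b3; simp; cases d1; cases d2; cases d3; simp)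
qed

lemma ereal_less_add_real:
  assumes "x \<le> y + ereal e" "y < ereal t"
  shows "x < ereal (t + e)"
  using assms by (cases x; cases y) auto

lemma ereal_add_real_less:
  assumes "x \<le> y + ereal e" "ereal (t + e) < x"
  shows "ereal t < y"
  using assms by (cases x; cases y) auto

lemma ereal_between_shifted:
  assumes "b + ereal e < d"
  shows "\<exists>t. b < ereal t \<and> ereal (t + e) < d"
proof -
  have "b < d - ereal e"
    using assms by (cases b; cases d) auto
  then obtain t where t: "b < ereal t" "ereal t < d - ereal e" using ereal_dense2 by blast
  then have "ereal (t + e) < d" by (cases d) auto
  then show ?thesis using t by blast
qed

lemma ex_bar_le_maximum:
  assumes "finite A" "A \<noteq> {}"
  shows "\<exists>l\<in>A. \<forall>k\<in>A. bar_le (a k) (a l)"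
proof -
  define R where "R = Max ((\<lambda>k. bar_rank (a k)) ` A)"
  define A' where "A' = {k \<in> A. bar_rank (a k) = R}"
  have "R \<in> (\<lambda>k. bar_rank (a k)) ` A"
    unfolding R_def using assms by (intro Max_in) auto
  then have A': "finite A'" "A' \<noteq> {}" using assms by (auto simp: A'_def)
  define P where "P = Max ((\<lambda>k. bar_pos (a k)) ` A')"
  have "P \<in> (\<lambda>k. bar_pos (a k)) ` A'"
    unfolding P_def using A' by (intro Max_in) auto
  then obtain l where l: "l \<in> A'" "bar_pos (a l) = P" by auto
  have "bar_le (a k) (a l)" if k: "k \<in> A" for k
  proof (cases "bar_rank (a k) = R")
    case True
    then have "bar_pos (a k) \<le> P"
      unfolding P_def using A' k by (intro Max_ge) (auto simp: A'_def)
    then show ?thesis using True l by (auto simp: bar_le_def A'_def)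
  next
    case False
    moreover have "bar_rank (a k) \<le> R" unfolding R_def using k assms by simp
    ultimately show ?thesis using l by (auto simp: bar_le_def A'_def)
  qed
  then show ?thesis using l by (auto simp: A'_def)
qed

text \<open>\<open>S\<close> and \<open>T\<close> are the matrices of the two natural
  transformations, \<open>u\<close> and \<open>v\<close> the weights, \<open>J j\<close> the
  interval behind \<open>b j\<close>. An entry of the product can be read off only at a
  \<open>t\<close> inside \<open>k\<close> with \<open>t + 2 * \<epsilon>\<close> inside
  \<open>l\<close>, and only bars alive at \<open>t + \<epsilon>\<close> mediate there; hence the
  form of \<open>comp\<close>.\<close>

lemma matching_of_long_bars:
  fixes a :: "'i \<Rightarrow> ereal \<times> ereal" and b :: "'j \<Rightarrow> ereal \<times> ereal"
    and S :: "'i \<Rightarrow> 'j \<Rightarrow> 'k::field" and T :: "'j \<Rightarrow> 'i \<Rightarrow> 'k" and J :: "'j \<Rightarrow> real set"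
  assumes \<epsilon>: "0 \<le> \<epsilon>"
    and proper_a: "\<And>i. i \<in> X \<Longrightarrow> proper_bar (a i)"
    and proper_b: "\<And>j. j \<in> Y \<Longrightarrow> proper_bar (b j)"
    and S: "\<And>i j. i \<in> X \<Longrightarrow> j \<in> Y \<Longrightarrow> S i j \<noteq> 0 \<Longrightarrow> bar_shift_le \<epsilon> (a i) (b j) \<and> u i = v j"
    and T: "\<And>i j. i \<in> X \<Longrightarrow> j \<in> Y \<Longrightarrow> T j i \<noteq> 0 \<Longrightarrow> bar_shift_le \<epsilon> (b j) (a i) \<and> u i = v j"
    and J: "\<And>j t. j \<in> Y \<Longrightarrow> fst (b j) < ereal t \<Longrightarrow> ereal t < snd (b j) \<Longrightarrow> t \<in> J j"
    and fin: "\<And>t. finite {j \<in> Y. t \<in> J j}"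
    and comp: "\<And>k l t. k \<in> X \<Longrightarrow> l \<in> X \<Longrightarrow> fst (a k) < ereal t \<Longrightarrow> ereal t < snd (a k) \<Longrightarrow>
      fst (a l) < ereal (t + 2 * \<epsilon>) \<Longrightarrow> ereal (t + 2 * \<epsilon>) < snd (a l) \<Longrightarrow>
      (\<Sum>j\<in>{j \<in> Y. t + \<epsilon> \<in> J j}. S k j * T j l) = (if k = l then 1 else 0)"
  shows "\<exists>f. inj_on f {i \<in> X. fst (a i) + ereal (2 * \<epsilon>) < snd (a i)} \<and>
    (\<forall>i\<in>{i \<in> X. fst (a i) + ereal (2 * \<epsilon>) < snd (a i)}. f i \<in> Y \<and> u i = v (f i) \<and>
      bar_shift_le \<epsilon> (a i) (b (f i)) \<and> bar_shift_le \<epsilon> (b (f i)) (a i))"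
proof -
  define L where "L = {i \<in> X. fst (a i) + ereal (2 * \<epsilon>) < snd (a i)}"
  define \<mu> where "\<mu> i = {j \<in> Y. u i = v j \<and> bar_shift_le \<epsilon> (a i) (b j) \<and> bar_shift_le \<epsilon> (b j) (a i)}" for i
  \<comment> \<open>If \<open>t\<close> and \<open>t + 2 * \<epsilon>\<close> are in the interior of
    \<open>i\<close>, every bar that is \<epsilon>-close to \<open>i\<close> contains the midpoint
    \<open>t + \<epsilon>\<close>, and only finitely many bars do.\<close>
  have fin_\<mu>: "finite (\<mu> i)" if i: "i \<in> L" for i
  proof -
    obtain t where t: "fst (a i) < ereal t" "ereal (t + 2 * \<epsilon>) < snd (a i)"
      using ereal_between_shifted i unfolding L_def by blast
    have "t + \<epsilon> \<in> J j" if j: "j \<in> \<mu> i" for j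
    proof (rule J)
      show "j \<in> Y" using j by (simp add: \<mu>_def)
      have "fst (b j) \<le> fst (a i) + ereal \<epsilon>" "snd (a i) \<le> snd (b j) + ereal \<epsilon>"
        using j by (auto simp: \<mu>_def bar_shift_le_def)
      then show "fst (b j) < ereal (t + \<epsilon>)" "ereal (t + \<epsilon>) < snd (b j)"
        using t ereal_add_real_less[of "snd (a i)" "snd (b j)" \<epsilon> "t + \<epsilon>"] ereal_less_add_real
        by (auto simp: add.assoc)
    qed
    then have "\<mu> i \<subseteq> {j \<in> Y. t + \<epsilon> \<in> J j}" by (auto simp: \<mu>_def)
    then show ?thesis using fin finite_subset by blast
  qed
  have "card A \<le> card (\<Union>i\<in>A. \<mu> i)" if A: "A \<subseteq> L" "finite A" for A
  proof (rule ccontr)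
    define N where "N = (\<Union>i\<in>A. \<mu> i)"
    assume "\<not> card A \<le> card (\<Union>i\<in>A. \<mu> i)"
    then have card: "card N < card A" by (simp add: N_def)
    have N: "finite N" "N \<subseteq> Y" using fin_\<mu> A by (auto simp: N_def \<mu>_def)
    have AX: "k \<in> X" if "k \<in> A" for k using that A by (auto simp: L_def)
    have long: "fst (a k) + ereal (2 * \<epsilon>) < snd (a k)" if "k \<in> A" for k
      using that A by (auto simp: L_def)
    \<comment> \<open>Only entries with \<open>bar_le (a k) (a l)\<close> are controlled, which is
      enough for triangularity. The index set \<open>N\<close> is the same for all of them, whereas
      the one in \<open>comp\<close> depends on \<open>t\<close>.\<close>
    have unit: "(\<Sum>j\<in>N. S k j * T j l) = (if k = l then 1 else 0)"
      if kl: "k \<in> A" "l \<in> A" "bar_le (a k) (a l)" for k l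
    proof -
      note X = AX[OF kl(1)] AX[OF kl(2)]
      note proper = proper_a[OF X(1)] proper_a[OF X(2)]
      have nz: "bar_shift_le \<epsilon> (a k) (b j) \<and> bar_shift_le \<epsilon> (b j) (a l) \<and> j \<in> N"
        if j: "j \<in> Y" "S k j * T j l \<noteq> 0" for j
      proof -
        have *: "bar_shift_le \<epsilon> (a k) (b j)" "bar_shift_le \<epsilon> (b j) (a l)" "u k = v j" "u l = v j"
          using j S[OF X(1) j(1)] T[OF X(2) j(1)] by auto
        have "j \<in> \<mu> k \<or> j \<in> \<mu> l"
          using bar_shift_le_chain_close[OF proper(1) proper_b[OF j(1)] proper(2) *(1,2) kl(3)] * j(1)
          by (auto simp: \<mu>_def)
        then show ?thesis using * kl by (auto simp: N_def)
      qed
      show ?thesis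
      \<comment> \<open>Either \<open>comp\<close> applies at some \<open>t\<close>, or every term
        vanishes: a nonzero term would yield both parts of the condition.\<close>
      proof (cases "bar_shift_le (2 * \<epsilon>) (a k) (a l) \<and> fst (a k) + ereal (2 * \<epsilon>) < snd (a l)")
        case True
        obtain t where t: "fst (a k) < ereal t" "ereal (t + 2 * \<epsilon>) < snd (a l)"
          using ereal_between_shifted True by blast
        have le: "fst (a l) \<le> fst (a k) + ereal (2 * \<epsilon>)" "snd (a l) \<le> snd (a k) + ereal (2 * \<epsilon>)"
          using True by (auto simp: bar_shift_le_def)
        have t': "ereal t < snd (a k)"
          using t(2) le(2) ereal_add_real_less by blast
        have t'': "fst (a l) < ereal (t + 2 * \<epsilon>)"
          using t(1) le(1) ereal_less_add_real by blast
        have mid: "t + \<epsilon> \<in> J j" if j: "j \<in> Y" "S k j * T j l \<noteq> 0" for j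
        proof (rule J[OF j(1)])
          have *: "fst (b j) \<le> fst (a k) + ereal \<epsilon>" "snd (a l) \<le> snd (b j) + ereal \<epsilon>"
            using nz[OF j] by (auto simp: bar_shift_le_def)
          show "fst (b j) < ereal (t + \<epsilon>)"
            using *(1) t(1) ereal_less_add_real by blast
          show "ereal (t + \<epsilon>) < snd (b j)"
            using *(2) t(2) ereal_add_real_less[of "snd (a l)" "snd (b j)" \<epsilon> "t + \<epsilon>"]
            by (simp add: add.assoc)
        qed
        have "(\<Sum>j\<in>N. S k j * T j l) = (\<Sum>j\<in>N \<inter> {j \<in> Y. t + \<epsilon> \<in> J j}. S k j * T j l)"
          using N mid by (intro sum.mono_neutral_right) auto
        also have "\<dots> = (\<Sum>j\<in>{j \<in> Y. t + \<epsilon> \<in> J j}. S k j * T j l)"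
          using fin nz by (intro sum.mono_neutral_left) auto
        finally show ?thesis using comp[OF X t(1) t' t'' t(2)] by simp
      next
        case False
        have "k \<noteq> l"
        proof
          assume "k = l"
          moreover have "bar_shift_le (2 * \<epsilon>) (a k) (a k)"
            using \<epsilon> by (cases "fst (a k)"; cases "snd (a k)") (auto simp: bar_shift_le_def)
          ultimately show False using False long[OF kl(1)] by simp
        qed
        moreover have "S k j * T j l = 0" if "j \<in> N" for j
        proof (rule ccontr)
          assume nonzero: "S k j * T j l \<noteq> 0"
          have j: "j \<in> Y" using that N by auto
          then show False
            using False nz[OF j nonzero] bar_shift_le_trans bar_shift_le_chain_overlap[OF proper(1)
                proper_b[OF j] proper(2) _ _ kl(3) long[OF kl(1)] long[OF kl(2)]] by blast
        qed
        ultimately show ?thesis by (simp add: sum.neutral)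
      qed
    qed
    \<comment> \<open>\<open>card N < card A\<close> makes the rows of \<open>S\<close> over
      \<open>N\<close> dependent. Pairing the dependence with column \<open>l\<close> of
      \<open>T\<close>, for the last bar \<open>l\<close> that occurs in it, leaves only
      \<open>x l\<close>, which is nonzero.\<close>
    obtain x where x: "\<exists>i\<in>A. x i \<noteq> 0" "\<forall>j\<in>N. (\<Sum>k\<in>A. x k * S k j) = 0"
      using homogeneous_system_nontrivial_solution[OF N(1) A(2) card, of S] by blast
    define D where "D = {k \<in> A. x k \<noteq> 0}"
    have D: "finite D" "D \<noteq> {}" using A(2) x(1) by (auto simp: D_def)
    obtain l where l: "l \<in> D" "\<And>k. k \<in> D \<Longrightarrow> bar_le (a k) (a l)"
      using ex_bar_le_maximum[OF D] by blast
    have "0 = (\<Sum>j\<in>N. (\<Sum>k\<in>A. x k * S k j) * T j l)" using x(2) by simp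
    also have "\<dots> = (\<Sum>j\<in>N. \<Sum>k\<in>A. x k * (S k j * T j l))"
      by (simp add: sum_distrib_right mult.assoc)
    also have "\<dots> = (\<Sum>k\<in>A. x k * (\<Sum>j\<in>N. S k j * T j l))"
      by (subst sum.swap) (simp add: sum_distrib_left)
    also have "\<dots> = (\<Sum>k\<in>A. if k = l then x k else 0)"
    proof (rule sum.cong[OF refl])
      fix k assume "k \<in> A"
      then show "x k * (\<Sum>j\<in>N. S k j * T j l) = (if k = l then x k else 0)"
        using unit[of k l] l by (cases "k \<in> D") (auto simp: D_def)
    qed
    also have "\<dots> = x l" using l(1) A(2) by (simp add: D_def)
    finally show False using l(1) by (simp add: D_def)
  qed
  then have "\<exists>f. inj_on f L \<and> (\<forall>i\<in>L. f i \<in> \<mu> i)"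
    using fin_\<mu> hall_infinite[of L \<mu>] by blast
  then show ?thesis unfolding L_def \<mu>_def by blast
qed

section \<open>Costs of matchings\<close>

abbreviation bar :: "wbar \<times> nat \<Rightarrow> ereal \<times> ereal" where
  "bar i \<equiv> fst (fst i)"

abbreviation weight :: "wbar \<times> nat \<Rightarrow> real" where
  "weight i \<equiv> snd (fst i)"

lemma endpoint_cost_le_iff:
  assumes "0 \<le> \<epsilon>"
  shows "endpoint_cost x y \<le> ennreal \<epsilon> \<longleftrightarrow> x \<le> y + ereal \<epsilon> \<and> y \<le> x + ereal \<epsilon>"
  using assms by (cases x; cases y) (auto simp: endpoint_cost_def ennreal_le_iff top_unique)

lemma matched_cost_le_iff:
  assumes "0 \<le> \<epsilon>"
  shows "matched_cost x y \<le> ennreal \<epsilon> \<longleftrightarrow>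
    bar_shift_le \<epsilon> (fst x) (fst y) \<and> bar_shift_le \<epsilon> (fst y) (fst x)"
  by (cases "(x, y)" rule: matched_cost.cases)
    (auto simp: endpoint_cost_le_iff[OF assms] bar_shift_le_def)

lemma unmatched_cost_le_iff:
  assumes "0 \<le> \<epsilon>" "proper_bar (fst x)"
  shows "unmatched_cost x \<le> ennreal \<epsilon> \<longleftrightarrow> snd (fst x) \<le> fst (fst x) + ereal (2 * \<epsilon>)"
proof -
  obtain b d w where [simp]: "x = ((b, d), w)" by (metis surj_pair)
  show ?thesis
    using assms unfolding proper_bar_def
    by (cases b; cases d) (auto simp: ennreal_le_iff top_unique field_simps)
qed

lemma matching_cost_le_iff:
  assumes \<epsilon>: "0 \<le> \<epsilon>" and "\<And>i. i \<in> copies B\<^sub>1 \<Longrightarrow> proper_bar (bar i)"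
    and "\<And>i. i \<in> copies B\<^sub>2 \<Longrightarrow> proper_bar (bar i)"
  shows "matching_cost B\<^sub>1 B\<^sub>2 \<gamma> \<le> ennreal \<epsilon> \<longleftrightarrow>
    (\<forall>(i, j)\<in>\<gamma>. bar_shift_le \<epsilon> (bar i) (bar j) \<and> bar_shift_le \<epsilon> (bar j) (bar i)) \<and>
    (\<forall>i\<in>copies B\<^sub>1 - Domain \<gamma>. snd (bar i) \<le> fst (bar i) + ereal (2 * \<epsilon>)) \<and>
    (\<forall>j\<in>copies B\<^sub>2 - Range \<gamma>. snd (bar j) \<le> fst (bar j) + ereal (2 * \<epsilon>))"
proof -
  have 1: "unmatched_cost (fst i) \<le> ennreal \<epsilon> \<longleftrightarrow> snd (bar i) \<le> fst (bar i) + ereal (2 * \<epsilon>)"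
    if "i \<in> copies B\<^sub>1 \<or> i \<in> copies B\<^sub>2" for i
    using that assms(2,3)[of i] by (intro unmatched_cost_le_iff \<epsilon>) blast
  have "matching_cost B\<^sub>1 B\<^sub>2 \<gamma> \<le> ennreal \<epsilon> \<longleftrightarrow>
    (\<forall>(i, j)\<in>\<gamma>. matched_cost (fst i) (fst j) \<le> ennreal \<epsilon>) \<and>
    (\<forall>i\<in>copies B\<^sub>1 - Domain \<gamma>. unmatched_cost (fst i) \<le> ennreal \<epsilon>) \<and>
    (\<forall>j\<in>copies B\<^sub>2 - Range \<gamma>. unmatched_cost (fst j) \<le> ennreal \<epsilon>)"
    unfolding matching_cost_def Sup_le_iff ball_Un ball_simps(9) by (auto simp: case_prod_beta)
  then show ?thesis
    unfolding matched_cost_le_iff[OF \<epsilon>] using 1 by auto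
qed

text \<open>Bars of length at most \<open>2 * \<epsilon>\<close> may stay unmatched at cost at most
  \<epsilon>, so only the longer ones have to be covered.\<close>

lemma weighted_matching_of_partial_injections:
  assumes \<epsilon>: "0 \<le> \<epsilon>" and proper1: "\<And>i. i \<in> copies B\<^sub>1 \<Longrightarrow> proper_bar (bar i)"
    and proper2: "\<And>i. i \<in> copies B\<^sub>2 \<Longrightarrow> proper_bar (bar i)"
    and f: "inj_on f {i \<in> copies B\<^sub>1. fst (bar i) + ereal (2 * \<epsilon>) < snd (bar i)}"
    "\<forall>i\<in>{i \<in> copies B\<^sub>1. fst (bar i) + ereal (2 * \<epsilon>) < snd (bar i)}. f i \<in> copies B\<^sub>2 \<and>
      weight i = weight (f i) \<and> bar_shift_le \<epsilon> (bar i) (bar (f i)) \<and> bar_shift_le \<epsilon> (bar (f i)) (bar i)"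
    and g: "inj_on g {i \<in> copies B\<^sub>2. fst (bar i) + ereal (2 * \<epsilon>) < snd (bar i)}"
    "\<forall>i\<in>{i \<in> copies B\<^sub>2. fst (bar i) + ereal (2 * \<epsilon>) < snd (bar i)}. g i \<in> copies B\<^sub>1 \<and>
      weight i = weight (g i) \<and> bar_shift_le \<epsilon> (bar i) (bar (g i)) \<and> bar_shift_le \<epsilon> (bar (g i)) (bar i)"
  shows "\<exists>\<gamma>. weighted_matching B\<^sub>1 B\<^sub>2 \<gamma> \<and> matching_cost B\<^sub>1 B\<^sub>2 \<gamma> \<le> ennreal \<epsilon>"
proof -
  let ?L = "\<lambda>B. {i \<in> copies B. fst (bar i) + ereal (2 * \<epsilon>) < snd (bar i)}"
  obtain \<gamma> where \<gamma>: "\<gamma> \<subseteq> {(x, f x) |x. x \<in> ?L B\<^sub>1} \<union> {(g y, y) |y. y \<in> ?L B\<^sub>2}"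
    "single_valued \<gamma>" "single_valued (\<gamma>\<inverse>)" "?L B\<^sub>1 \<subseteq> Domain \<gamma>" "?L B\<^sub>2 \<subseteq> Range \<gamma>"
    using combine_partial_injections[OF f(1) g(1)] by blast
  have pair: "i \<in> copies B\<^sub>1 \<and> j \<in> copies B\<^sub>2 \<and> weight i = weight j \<and>
      bar_shift_le \<epsilon> (bar i) (bar j) \<and> bar_shift_le \<epsilon> (bar j) (bar i)" if "(i, j) \<in> \<gamma>" for i j
    using subsetD[OF \<gamma>(1) that] f(2) g(2) by auto
  have "weighted_matching B\<^sub>1 B\<^sub>2 \<gamma>"
    unfolding weighted_matching_def using \<gamma>(2,3) pair by auto
  moreover have "matching_cost B\<^sub>1 B\<^sub>2 \<gamma> \<le> ennreal \<epsilon>"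
  proof (intro iffD2[OF matching_cost_le_iff[OF \<epsilon>]] conjI ballI)
    show "proper_bar (bar i)" if "i \<in> copies B\<^sub>1" for i using proper1[OF that] .
    show "proper_bar (bar i)" if "i \<in> copies B\<^sub>2" for i using proper2[OF that] .
    show "case p of (i, j) \<Rightarrow> bar_shift_le \<epsilon> (bar i) (bar j) \<and> bar_shift_le \<epsilon> (bar j) (bar i)"
      if "p \<in> \<gamma>" for p
      using pair that by (cases p) auto
    show "snd (bar i) \<le> fst (bar i) + ereal (2 * \<epsilon>)" if "i \<in> copies B\<^sub>1 - Domain \<gamma>" for i
      using that \<gamma>(4) not_less by blast
    show "snd (bar i) \<le> fst (bar i) + ereal (2 * \<epsilon>)" if "i \<in> copies B\<^sub>2 - Range \<gamma>" for i
      using that \<gamma>(5) not_less by blast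
  qed
  ultimately show ?thesis by blast
qed

section \<open>Stability\<close>

lemma birth_less_less_death_imp_mem:
  assumes "is_interval J" "birth J < ereal t" "ereal t < death J"
  shows "t \<in> J"
proof -
  obtain a b where "a \<in> J" "a < t" "b \<in> J" "t < b"
    using assms(2,3) by (auto simp: birth_def death_def Inf_less_iff less_Sup_iff)
  then show ?thesis
    using assms(1) unfolding is_interval_1 by (meson less_imp_le)
qed

lemma birth_le_add:
  assumes "\<And>s. s \<in> I \<Longrightarrow> \<exists>u\<in>J. u \<le> s + e"
  shows "birth J \<le> birth I + ereal e"
proof -
  have "birth J - ereal e \<le> birth I"
    unfolding birth_def[of I]
  proof (rule INF_greatest)
    fix s assume "s \<in> I"
    then obtain u where u: "u \<in> J" "u \<le> s + e" using assms by blast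
    have "birth J \<le> ereal u" unfolding birth_def using u(1) by (intro INF_lower)
    also have "\<dots> \<le> ereal (s + e)" using u(2) by simp
    finally show "birth J - ereal e \<le> ereal s" by (cases "birth J") auto
  qed
  then show ?thesis by (cases "birth J"; cases "birth I") auto
qed

lemma death_le_add:
  assumes "\<And>u. u \<in> J \<Longrightarrow> \<exists>s\<in>I. u \<le> s + e"
  shows "death J \<le> death I + ereal e"
  unfolding death_def[of J]
proof (rule SUP_least)
  fix u assume "u \<in> J"
  then obtain s where s: "s \<in> I" "u \<le> s + e" using assms by blast
  have "ereal s \<le> death I" unfolding death_def using s(1) by (intro SUP_upper)
  then show "ereal u \<le> death I + ereal e" using s(2) by (cases "death I") auto
qed

text \<open>
  A basis of a weighted persistence module in which the structure maps are diagonal: \<open>C t x i\<close> is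
  the coordinate of \<open>x\<close> at the bar \<open>i\<close>, which lives on the interval \<open>iv i\<close>.
\<close>

locale bar_basis =
  fixes V :: "('k::field, 'v::ab_group_add) wpmod" and B :: "wbar \<Rightarrow> nat"
    and iv :: "wbar \<times> nat \<Rightarrow> real set" and C :: "real \<Rightarrow> 'v \<Rightarrow> wbar \<times> nat \<Rightarrow> 'k"
  assumes wpm: "weighted_persistence_module V"
    and iv_interval: "i \<in> copies B \<Longrightarrow> is_interval (iv i)"
    and iv_nonempty: "i \<in> copies B \<Longrightarrow> iv i \<noteq> {}"
    and birth_iv: "i \<in> copies B \<Longrightarrow> birth (iv i) = fst (bar i)"
    and death_iv: "i \<in> copies B \<Longrightarrow> death (iv i) = snd (bar i)"
    and weight_nonneg: "i \<in> copies B \<Longrightarrow> 0 \<le> weight i"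
    and finite_bars: "finite {i \<in> copies B. t \<in> iv i}"
    and C_support: "x \<in> vsp V t \<Longrightarrow> C t x i \<noteq> 0 \<Longrightarrow> i \<in> copies B \<and> t \<in> iv i"
    and C_add: "x \<in> vsp V t \<Longrightarrow> y \<in> vsp V t \<Longrightarrow> C t (x + y) i = C t x i + C t y i"
    and C_scale: "x \<in> vsp V t \<Longrightarrow> C t (scl V a x) i = a * C t x i"
    and C_inject: "x \<in> vsp V t \<Longrightarrow> y \<in> vsp V t \<Longrightarrow> (\<And>i. C t x i = C t y i) \<Longrightarrow> x = y"
    and C_surj: "(\<And>i. f i \<noteq> 0 \<Longrightarrow> i \<in> copies B \<and> t \<in> iv i) \<Longrightarrow> \<exists>x\<in>vsp V t. C t x = f"
    and C_tmap: "s \<le> t \<Longrightarrow> x \<in> vsp V s \<Longrightarrow> C t (tmap V s t x) i = (if t \<in> iv i then C s x i else 0)"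
    and C_grade: "0 \<le> w \<Longrightarrow> x \<in> vsp V t \<Longrightarrow>
      x \<in> grade V t w \<longleftrightarrow> (\<forall>i. C t x i \<noteq> 0 \<longrightarrow> weight i = w)"
begin

lemma pm: "persistence_module V"
  using wpm by (simp add: weighted_persistence_module_def)

sublocale vector_space "scl V"
  using pm by (simp add: persistence_module_def)

lemma vsp_subspace: "subspace (vsp V t)"
  using pm by (simp add: persistence_module_def)

lemma tmap_mem: "s \<le> t \<Longrightarrow> x \<in> vsp V s \<Longrightarrow> tmap V s t x \<in> vsp V t"
  using pm unfolding persistence_module_def linear_between_def by blast

lemma proper_bar: "i \<in> copies B \<Longrightarrow> proper_bar (bar i)"
proof -
  assume i: "i \<in> copies B"
  obtain t where t: "t \<in> iv i" using iv_nonempty[OF i] by blast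
  have "birth (iv i) \<le> ereal t" "ereal t \<le> death (iv i)"
    unfolding birth_def death_def using t by (auto intro: INF_lower SUP_upper)
  then show ?thesis using birth_iv[OF i] death_iv[OF i] by (auto simp: proper_bar_def)
qed

lemma mem_iv_if_between:
  "i \<in> copies B \<Longrightarrow> fst (bar i) < ereal t \<Longrightarrow> ereal t < snd (bar i) \<Longrightarrow> t \<in> iv i"
  by (rule birth_less_less_death_imp_mem) (simp_all add: iv_interval birth_iv death_iv)

lemma C_zero: "C t 0 i = 0"
  using C_scale[of 0 t 0 i] subspace_0[OF vsp_subspace] by simp

lemma C_sum: "finite A \<Longrightarrow> (\<And>a. a \<in> A \<Longrightarrow> f a \<in> vsp V t) \<Longrightarrow> C t (sum f A) i = (\<Sum>a\<in>A. C t (f a) i)"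
proof (induction A rule: finite_induct)
  case (insert a A)
  then have "sum f A \<in> vsp V t" by (intro subspace_sum[OF vsp_subspace]) auto
  then show ?case using insert by (simp add: C_add)
qed (simp add: C_zero)

definition vec :: "real \<Rightarrow> (wbar \<times> nat \<Rightarrow> 'k) \<Rightarrow> 'v" where
  "vec t f = (SOME x. x \<in> vsp V t \<and> C t x = f)"

lemma vec:
  assumes "\<And>i. f i \<noteq> 0 \<Longrightarrow> i \<in> copies B \<and> t \<in> iv i"
  shows "vec t f \<in> vsp V t" "C t (vec t f) = f"
  using someI_ex[OF C_surj[OF assms, unfolded Bex_def]] unfolding vec_def by auto

definition e :: "real \<Rightarrow> wbar \<times> nat \<Rightarrow> 'v" where
  "e t i = vec t (\<lambda>k. if k = i then 1 else 0)"

context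
  fixes i t assumes i: "i \<in> copies B" and t: "t \<in> iv i"
begin

lemma e_mem: "e t i \<in> vsp V t"
  unfolding e_def using i t by (intro vec(1)) (simp split: if_splits)

lemma C_e: "C t (e t i) k = (if k = i then 1 else 0)"
  unfolding e_def using i t by (subst vec(2)) (simp_all split: if_splits)

lemma e_grade: "e t i \<in> grade V t (weight i)"
  by (subst C_grade[OF weight_nonneg[OF i] e_mem]) (simp add: C_e del: split_paired_All)

lemma tmap_e: "t \<le> u \<Longrightarrow> u \<in> iv i \<Longrightarrow> tmap V t u (e t i) = e u i"
  using i t by (intro C_inject[of _ u])
    (auto simp: C_tmap e_mem tmap_mem C_e bar_basis.e_mem[OF bar_basis_axioms] bar_basis.C_e[OF bar_basis_axioms])

lemma tmap_e_eq_0: "t \<le> u \<Longrightarrow> u \<notin> iv i \<Longrightarrow> tmap V t u (e t i) = 0"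
  by (intro C_inject[of _ u])
    (auto simp: C_tmap e_mem tmap_mem C_e C_zero subspace_0[OF vsp_subspace])

end

lemma e_expansion:
  assumes x: "x \<in> vsp V t"
  shows "x = (\<Sum>i\<in>{i \<in> copies B. t \<in> iv i}. scl V (C t x i) (e t i))"
proof (rule C_inject[OF x])
  have mem: "scl V a (e t i) \<in> vsp V t" if "i \<in> {i \<in> copies B. t \<in> iv i}" for a i
    using that by (intro subspace_scale[OF vsp_subspace] e_mem) auto
  then show "(\<Sum>i\<in>{i \<in> copies B. t \<in> iv i}. scl V (C t x i) (e t i)) \<in> vsp V t"
    by (intro subspace_sum[OF vsp_subspace])
  fix k
  have "C t (\<Sum>i\<in>{i \<in> copies B. t \<in> iv i}. scl V (C t x i) (e t i)) k =
      (\<Sum>i\<in>{i \<in> copies B. t \<in> iv i}. C t (scl V (C t x i) (e t i)) k)"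
    using finite_bars mem by (rule C_sum)
  also have "\<dots> = (\<Sum>i\<in>{i \<in> copies B. t \<in> iv i}. if i = k then C t x i else 0)"
    by (rule sum.cong) (auto simp: C_scale e_mem C_e)
  also have "\<dots> = C t x k"
    using finite_bars C_support[OF x, of k] by auto
  finally show "C t x k = C t (\<Sum>i\<in>{i \<in> copies B. t \<in> iv i}. scl V (C t x i) (e t i)) k" by simp
qed

end

section \<open>Matrix of a natural transformation into a shifted module\<close>

locale bar_basis_hom = V: bar_basis V BV ivV CV + W: bar_basis W BW ivW CW
  for V :: "('k::field, 'v::ab_group_add) wpmod" and BV ivV CV
    and W :: "('k, 'w::ab_group_add) wpmod" and BW ivW CW +
  fixes \<epsilon> :: real and \<phi> :: "real \<Rightarrow> 'v \<Rightarrow> 'w"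
  assumes nt: "weighted_nat_trans V (shift \<epsilon> W) \<phi>"
begin

lemma linear_\<phi>: "linear_between (scl V) (vsp V t) (scl W) (vsp W (t + \<epsilon>)) (\<phi> t)"
  using nt by (simp add: weighted_nat_trans_def nat_trans_def shift_def)

lemma \<phi>_mem: "x \<in> vsp V t \<Longrightarrow> \<phi> t x \<in> vsp W (t + \<epsilon>)"
  and \<phi>_add: "x \<in> vsp V t \<Longrightarrow> y \<in> vsp V t \<Longrightarrow> \<phi> t (x + y) = \<phi> t x + \<phi> t y"
  and \<phi>_scale: "x \<in> vsp V t \<Longrightarrow> \<phi> t (scl V a x) = scl W a (\<phi> t x)"
  using linear_\<phi>[of t] by (auto simp: linear_between_def)

lemma \<phi>_tmap: "s \<le> t \<Longrightarrow> x \<in> vsp V s \<Longrightarrow> \<phi> t (tmap V s t x) = tmap W (s + \<epsilon>) (t + \<epsilon>) (\<phi> s x)"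
  using nt by (simp add: weighted_nat_trans_def nat_trans_def shift_def)

lemma \<phi>_grade: "0 \<le> w \<Longrightarrow> x \<in> grade V t w \<Longrightarrow> \<phi> t x \<in> grade W (t + \<epsilon>) w"
  using nt by (auto simp: weighted_nat_trans_def shift_def)

lemma \<phi>_zero: "\<phi> t 0 = 0"
  using \<phi>_scale[of 0 t 0] V.subspace_0[OF V.vsp_subspace] by simp

lemma \<phi>_sum: "finite A \<Longrightarrow> (\<And>a. a \<in> A \<Longrightarrow> f a \<in> vsp V t) \<Longrightarrow> \<phi> t (sum f A) = (\<Sum>a\<in>A. \<phi> t (f a))"
proof (induction A rule: finite_induct)
  case (insert a A)
  then have "sum f A \<in> vsp V t" by (intro V.subspace_sum[OF V.vsp_subspace]) auto
  then show ?case using insert by (simp add: \<phi>_add)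
qed (simp add: \<phi>_zero)

text \<open>The matrix entry of \<open>\<phi>\<close> at \<open>i\<close> and \<open>j\<close>. A
  morphism between interval modules is a single scalar wherever both intervals are alive, so any
  such \<open>t\<close> may be chosen; \<open>C_\<phi>_e\<close> shows the independence.\<close>

definition coef :: "wbar \<times> nat \<Rightarrow> wbar \<times> nat \<Rightarrow> 'k" where
  "coef i j = (if \<exists>t. t \<in> ivV i \<and> t + \<epsilon> \<in> ivW j
     then let t = (SOME t. t \<in> ivV i \<and> t + \<epsilon> \<in> ivW j) in CW (t + \<epsilon>) (\<phi> t (V.e t i)) j else 0)"

text \<open>Naturality carries the coordinate from \<open>s\<close> to \<open>t\<close>. The point
  \<open>s + \<epsilon>\<close> may lie outside \<open>ivW j\<close>, and then both sides vanish;
  this is how \<open>down\<close> in \<open>coef_nonzero\<close> obtains membership.\<close>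

lemma C_\<phi>_e_mono:
  assumes "i \<in> copies BV" "s \<in> ivV i" "t \<in> ivV i" "s \<le> t" "t + \<epsilon> \<in> ivW j"
  shows "CW (t + \<epsilon>) (\<phi> t (V.e t i)) j = CW (s + \<epsilon>) (\<phi> s (V.e s i)) j"
proof -
  have "\<phi> t (V.e t i) = tmap W (s + \<epsilon>) (t + \<epsilon>) (\<phi> s (V.e s i))"
    using assms by (simp add: V.tmap_e[symmetric, of i s t] \<phi>_tmap V.e_mem)
  then show ?thesis using assms by (simp add: W.C_tmap \<phi>_mem V.e_mem)
qed

lemma C_\<phi>_e:
  assumes i: "i \<in> copies BV" and t: "t \<in> ivV i" "t + \<epsilon> \<in> ivW j"
  shows "CW (t + \<epsilon>) (\<phi> t (V.e t i)) j = coef i j"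
proof -
  define u where "u = (SOME t. t \<in> ivV i \<and> t + \<epsilon> \<in> ivW j)"
  have u: "u \<in> ivV i" "u + \<epsilon> \<in> ivW j"
    using someI[of "\<lambda>t. t \<in> ivV i \<and> t + \<epsilon> \<in> ivW j" t] t by (auto simp: u_def)
  have "coef i j = CW (u + \<epsilon>) (\<phi> u (V.e u i)) j"
    using t by (auto simp: coef_def Let_def u_def)
  then show ?thesis
    using C_\<phi>_e_mono[OF i t(1) u(1) _ u(2)] C_\<phi>_e_mono[OF i u(1) t(1) _ t(2)]
    by (cases "t \<le> u") auto
qed

text \<open>A nonzero coordinate at \<open>t\<close> comes from every earlier parameter at which
  \<open>i\<close> is alive, so \<open>j\<close> is born at most \<epsilon> after \<open>i\<close>.
  Once \<open>i\<close> has died its image is zero, so \<open>j\<close> dies at most \<epsilon>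
  after \<open>i\<close>. The weights agree because \<open>\<phi>\<close> preserves grades.\<close>

lemma coef_nonzero:
  assumes i: "i \<in> copies BV" and j: "j \<in> copies BW" and nz: "coef i j \<noteq> 0"
  shows "bar_shift_le \<epsilon> (bar i) (bar j) \<and> weight i = weight j"
proof -
  obtain t where t: "t \<in> ivV i" "t + \<epsilon> \<in> ivW j"
    using nz by (auto simp: coef_def split: if_splits)
  have nzt: "CW (t + \<epsilon>) (\<phi> t (V.e t i)) j \<noteq> 0" using C_\<phi>_e[OF i t] nz by simp
  have down: "s + \<epsilon> \<in> ivW j" if s: "s \<in> ivV i" "s \<le> t" for s
  proof -
    have "CW (s + \<epsilon>) (\<phi> s (V.e s i)) j \<noteq> 0" using C_\<phi>_e_mono[OF i s(1) t(1) s(2) t(2)] nzt by simp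
    then show ?thesis using W.C_support[OF \<phi>_mem[OF V.e_mem[OF i s(1)]]] by blast
  qed
  have up: "u \<in> ivV i" if u: "t \<le> u" "u + \<epsilon> \<in> ivW j" for u
  proof (rule ccontr)
    assume "u \<notin> ivV i"
    then have "tmap W (t + \<epsilon>) (u + \<epsilon>) (\<phi> t (V.e t i)) = 0"
      using \<phi>_tmap[OF u(1) V.e_mem[OF i t(1)]] V.tmap_e_eq_0[OF i t(1) u(1)] \<phi>_zero by simp
    then show False
      using W.C_tmap[OF _ \<phi>_mem[OF V.e_mem[OF i t(1)]], of "u + \<epsilon>" j] u nzt W.C_zero by simp
  qed
  have "birth (ivW j) \<le> birth (ivV i) + ereal \<epsilon>"
  proof (rule birth_le_add)
    fix s assume "s \<in> ivV i"
    \<comment> \<open>\<open>down\<close> covers parameters up to \<open>t\<close>; beyond them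
      \<open>t + \<epsilon>\<close> itself is a witness, hence the minimum. The maximum below is
      dual.\<close>
    then show "\<exists>u\<in>ivW j. u \<le> s + \<epsilon>"
      using down t(2) by (intro bexI[of _ "min s t + \<epsilon>"]) (auto simp: min_def)
  qed
  moreover have "death (ivW j) \<le> death (ivV i) + ereal \<epsilon>"
  proof (rule death_le_add)
    fix u assume "u \<in> ivW j"
    then show "\<exists>s\<in>ivV i. u \<le> s + \<epsilon>"
      using up[of "u - \<epsilon>"] t(1) by (intro bexI[of _ "max (u - \<epsilon>) t"]) (auto simp: max_def)
  qed
  moreover have "weight i = weight j"
  proof -
    have "\<phi> t (V.e t i) \<in> grade W (t + \<epsilon>) (weight i)"
      using V.e_grade[OF i t(1)] V.weight_nonneg[OF i] by (rule \<phi>_grade[rotated])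
    then show ?thesis
      using W.C_grade[OF V.weight_nonneg[OF i] \<phi>_mem[OF V.e_mem[OF i t(1)]]] nzt by metis
  qed
  ultimately show ?thesis
    using i j by (simp add: bar_shift_le_def V.birth_iv V.death_iv W.birth_iv W.death_iv)
qed

lemma C_\<phi>:
  assumes x: "x \<in> vsp V t" and j: "t + \<epsilon> \<in> ivW j"
  shows "CW (t + \<epsilon>) (\<phi> t x) j = (\<Sum>i\<in>{i \<in> copies BV. t \<in> ivV i}. CV t x i * coef i j)"
proof -
  have mem: "scl V a (V.e t i) \<in> vsp V t" if "i \<in> {i \<in> copies BV. t \<in> ivV i}" for a i
    using that by (intro V.subspace_scale[OF V.vsp_subspace] V.e_mem) auto
  have "\<phi> t x = \<phi> t (\<Sum>i\<in>{i \<in> copies BV. t \<in> ivV i}. scl V (CV t x i) (V.e t i))"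
    using V.e_expansion[OF x] by simp
  also have "\<dots> = (\<Sum>i\<in>{i \<in> copies BV. t \<in> ivV i}. \<phi> t (scl V (CV t x i) (V.e t i)))"
    using V.finite_bars mem by (rule \<phi>_sum)
  finally have "CW (t + \<epsilon>) (\<phi> t x) j =
      (\<Sum>i\<in>{i \<in> copies BV. t \<in> ivV i}. CW (t + \<epsilon>) (\<phi> t (scl V (CV t x i) (V.e t i))) j)"
    using W.C_sum[OF V.finite_bars \<phi>_mem[OF mem]] by simp
  also have "\<dots> = (\<Sum>i\<in>{i \<in> copies BV. t \<in> ivV i}. CV t x i * coef i j)"
    using j by (intro sum.cong) (auto simp: \<phi>_scale V.e_mem W.C_scale \<phi>_mem C_\<phi>_e)
  finally show ?thesis .
qed

end

text \<open>Evaluated at a basis vector, the interleaving equation says that the product of the two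
  matrices is the diagonal matrix of the structure map over \<open>2 * \<epsilon>\<close>. The lemma
  is used a second time with \<open>V\<close> and \<open>W\<close> exchanged.\<close>

lemma (in bar_basis_hom) long_bars_matching:
  assumes \<epsilon>: "0 \<le> \<epsilon>"
    and \<psi>: "weighted_nat_trans W (shift \<epsilon> V) \<psi>"
    and \<psi>\<phi>: "\<And>t x. x \<in> vsp V t \<Longrightarrow> \<psi> (t + \<epsilon>) (\<phi> t x) = tmap V t (t + 2 * \<epsilon>) x"
  shows "\<exists>f. inj_on f {i \<in> copies BV. fst (bar i) + ereal (2 * \<epsilon>) < snd (bar i)} \<and>
    (\<forall>i\<in>{i \<in> copies BV. fst (bar i) + ereal (2 * \<epsilon>) < snd (bar i)}. f i \<in> copies BW \<and>
      weight i = weight (f i) \<and> bar_shift_le \<epsilon> (bar i) (bar (f i)) \<and> bar_shift_le \<epsilon> (bar (f i)) (bar i))"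
proof -
  interpret h: bar_basis_hom W BW ivW CW V BV ivV CV \<epsilon> \<psi> by unfold_locales (rule \<psi>)
  show ?thesis
  proof (rule matching_of_long_bars[where S = coef and T = h.coef and J = ivW])
    show "0 \<le> \<epsilon>" by fact
    show "proper_bar (bar i)" if "i \<in> copies BV" for i using V.proper_bar[OF that] .
    show "proper_bar (bar i)" if "i \<in> copies BW" for i using W.proper_bar[OF that] .
    show "bar_shift_le \<epsilon> (bar i) (bar j) \<and> weight i = weight j"
      if "i \<in> copies BV" "j \<in> copies BW" "coef i j \<noteq> 0" for i j
      using coef_nonzero[OF that] .
    show "bar_shift_le \<epsilon> (bar j) (bar i) \<and> weight i = weight j"
      if "i \<in> copies BV" "j \<in> copies BW" "h.coef j i \<noteq> 0" for i j
      using h.coef_nonzero[OF that(2,1,3)] by simp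
    show "t \<in> ivW j" if "j \<in> copies BW" "fst (bar j) < ereal t" "ereal t < snd (bar j)" for j t
      using W.mem_iv_if_between[OF that] .
    show "finite {j \<in> copies BW. t \<in> ivW j}" for t by (rule W.finite_bars)
    fix k l t
    assume kl: "k \<in> copies BV" "l \<in> copies BV"
      and "fst (bar k) < ereal t" "ereal t < snd (bar k)"
        "fst (bar l) < ereal (t + 2 * \<epsilon>)" "ereal (t + 2 * \<epsilon>) < snd (bar l)"
    then have k: "t \<in> ivV k" and l: "t + 2 * \<epsilon> \<in> ivV l" by (auto intro: V.mem_iv_if_between)
    have l': "t + \<epsilon> + \<epsilon> \<in> ivV l" using l by (simp add: add.assoc)
    have e: "V.e t k \<in> vsp V t" by (rule V.e_mem[OF kl(1) k])
    have "(\<Sum>j\<in>{j \<in> copies BW. t + \<epsilon> \<in> ivW j}. coef k j * h.coef j l) =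
        (\<Sum>j\<in>{j \<in> copies BW. t + \<epsilon> \<in> ivW j}. CW (t + \<epsilon>) (\<phi> t (V.e t k)) j * h.coef j l)"
      using C_\<phi>_e[OF kl(1) k] by (intro sum.cong) auto
    also have "\<dots> = CV (t + \<epsilon> + \<epsilon>) (\<psi> (t + \<epsilon>) (\<phi> t (V.e t k))) l"
      using h.C_\<phi>[OF \<phi>_mem[OF e] l'] by simp
    also have "\<dots> = CV (t + 2 * \<epsilon>) (tmap V t (t + 2 * \<epsilon>) (V.e t k)) l"
      by (simp add: \<psi>\<phi>[OF e] add.assoc)
    also have "\<dots> = (if k = l then 1 else 0)"
      using \<epsilon> l by (auto simp: V.C_tmap e V.C_e[OF kl(1) k])
    finally show "(\<Sum>j\<in>{j \<in> copies BW. t + \<epsilon> \<in> ivW j}. coef k j * h.coef j l) = (if k = l then 1 else 0)" .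
  qed
qed

theorem bottleneck_le_of_interleaved:
  assumes "bar_basis V BV ivV CV" "bar_basis W BW ivW CW" and \<epsilon>: "0 \<le> \<epsilon>" "interleaved \<epsilon> V W"
  shows "\<exists>\<gamma>. weighted_matching BV BW \<gamma> \<and> matching_cost BV BW \<gamma> \<le> ennreal \<epsilon>"
proof -
  interpret V: bar_basis V BV ivV CV by fact
  interpret W: bar_basis W BW ivW CW by fact
  obtain \<phi> \<psi> where \<phi>: "weighted_nat_trans V (shift \<epsilon> W) \<phi>" and \<psi>: "weighted_nat_trans W (shift \<epsilon> V) \<psi>"
    and \<psi>\<phi>: "\<And>t x. x \<in> vsp V t \<Longrightarrow> \<psi> (t + \<epsilon>) (\<phi> t x) = tmap V t (t + 2 * \<epsilon>) x"
    and \<phi>\<psi>: "\<And>t x. x \<in> vsp W t \<Longrightarrow> \<phi> (t + \<epsilon>) (\<psi> t x) = tmap W t (t + 2 * \<epsilon>) x"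
    using \<epsilon>(2) unfolding interleaved_def by blast
  interpret f: bar_basis_hom V BV ivV CV W BW ivW CW \<epsilon> \<phi> by unfold_locales (rule \<phi>)
  interpret g: bar_basis_hom W BW ivW CW V BV ivV CV \<epsilon> \<psi> by unfold_locales (rule \<psi>)
  show ?thesis
    using f.long_bars_matching[OF \<epsilon>(1) \<psi> \<psi>\<phi>] g.long_bars_matching[OF \<epsilon>(1) \<phi> \<phi>\<psi>]
      weighted_matching_of_partial_injections[OF \<epsilon>(1) V.proper_bar W.proper_bar] by blast
qed

section \<open>Interleavings from matchings\<close>

text \<open>For naturality: a coordinate alive in \<open>I\<close> at \<open>s\<close> and in
  \<open>J\<close> at \<open>t + \<epsilon>\<close> must be killed on neither path of the square. By
  the strict \<delta> < \<epsilon>, \<open>J\<close> has a point below \<open>s + \<epsilon>\<close>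
  and \<open>I\<close> one above \<open>t\<close>, whatever the kind of endpoints; convexity does
  the rest.\<close>

lemma interval_shift_between:
  assumes I: "is_interval I" and J: "is_interval J" and "\<delta> < \<epsilon>"
    and le: "bar_shift_le \<delta> (birth I, death I) (birth J, death J)"
    and s: "s \<in> I" and t: "t + \<epsilon> \<in> J" and st: "s \<le> t"
  shows "s + \<epsilon> \<in> J \<and> t \<in> I"
proof
  have "birth I \<le> ereal s" unfolding birth_def using s by (intro INF_lower)
  moreover have "birth J \<le> birth I + ereal \<delta>" using le by (simp add: bar_shift_le_def)
  ultimately have "birth J < ereal (s + \<epsilon>)"
    using \<open>\<delta> < \<epsilon>\<close> by (cases "birth J"; cases "birth I") auto
  then obtain a where "a \<in> J" "a < s + \<epsilon>" by (auto simp: birth_def Inf_less_iff)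
  then show "s + \<epsilon> \<in> J"
    using J t st unfolding is_interval_1 by (meson add_le_cancel_right less_imp_le)
  have "ereal (t + \<epsilon>) \<le> death J" unfolding death_def using t by (intro SUP_upper)
  moreover have "death J \<le> death I + ereal \<delta>" using le by (simp add: bar_shift_le_def)
  ultimately have "ereal t < death I"
    using \<open>\<delta> < \<epsilon>\<close> by (cases "death J"; cases "death I") auto
  then obtain b where "b \<in> I" "t < b" by (auto simp: death_def less_Sup_iff)
  then show "t \<in> I"
    using I s st unfolding is_interval_1 by (meson less_imp_le)
qed

text \<open>For the composite of the two maps: a coordinate that survives
  \<open>2 * \<epsilon>\<close> in \<open>I\<close> must not be lost halfway in
  \<open>J\<close>.\<close>

lemma interval_shift_mid:
  assumes J: "is_interval J" and "\<delta> < \<epsilon>"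
    and le: "bar_shift_le \<delta> (birth I, death I) (birth J, death J)"
      "bar_shift_le \<delta> (birth J, death J) (birth I, death I)"
    and t: "t \<in> I" "t + 2 * \<epsilon> \<in> I"
  shows "t + \<epsilon> \<in> J"
proof (rule birth_less_less_death_imp_mem[OF J])
  have "birth I \<le> ereal t" unfolding birth_def using t by (intro INF_lower)
  moreover have "birth J \<le> birth I + ereal \<delta>" using le by (simp add: bar_shift_le_def)
  ultimately show "birth J < ereal (t + \<epsilon>)"
    using \<open>\<delta> < \<epsilon>\<close> by (cases "birth J"; cases "birth I") auto
  have "ereal (t + 2 * \<epsilon>) \<le> death I" unfolding death_def using t by (intro SUP_upper)
  moreover have "death I \<le> death J + ereal \<delta>" using le by (simp add: bar_shift_le_def)
  ultimately show "ereal (t + \<epsilon>) < death J"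
    using \<open>\<delta> < \<epsilon>\<close> by (cases "death J"; cases "death I") auto
qed

text \<open>Unmatched bars are sent to zero, so the structure map over \<open>2 * \<epsilon>\<close>
  has to kill them too.\<close>

lemma short_interval_shift:
  assumes "\<delta> < \<epsilon>" "death I \<le> birth I + ereal (2 * \<delta>)" "t \<in> I"
  shows "t + 2 * \<epsilon> \<notin> I"
proof
  assume "t + 2 * \<epsilon> \<in> I"
  then have "ereal (t + 2 * \<epsilon>) \<le> death I" unfolding death_def by (intro SUP_upper)
  moreover have "birth I \<le> ereal t" unfolding birth_def using assms(3) by (intro INF_lower)
  ultimately show False
    using assms(1,2) by (cases "death I"; cases "birth I") auto
qed

text \<open>\<open>short\<close> concerns the bars of \<open>V\<close> only; for those of
  \<open>W\<close> the locale is interpreted again with the converse of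
  \<open>\<gamma>\<close>.\<close>

locale bar_basis_matching = V: bar_basis V BV ivV CV + W: bar_basis W BW ivW CW
  for V :: "('k::field, 'v::ab_group_add) wpmod" and BV ivV CV
    and W :: "('k, 'w::ab_group_add) wpmod" and BW ivW CW +
  fixes \<delta> \<epsilon> :: real and \<gamma> :: "((wbar \<times> nat) \<times> (wbar \<times> nat)) set"
  assumes matching: "weighted_matching BV BW \<gamma>" and less: "\<delta> < \<epsilon>"
    and close: "(i, j) \<in> \<gamma> \<Longrightarrow> bar_shift_le \<delta> (bar i) (bar j) \<and> bar_shift_le \<delta> (bar j) (bar i)"
    and short: "i \<in> copies BV - Domain \<gamma> \<Longrightarrow> snd (bar i) \<le> fst (bar i) + ereal (2 * \<delta>)"
begin

lemma mem_copies: "(i, j) \<in> \<gamma> \<Longrightarrow> i \<in> copies BV \<and> j \<in> copies BW"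
  using matching unfolding weighted_matching_def by blast

lemma weight_eq: "(i, j) \<in> \<gamma> \<Longrightarrow> weight i = weight j"
  using matching unfolding weighted_matching_def by blast

lemma bounds:
  assumes "(i, j) \<in> \<gamma>"
  shows "bar_shift_le \<delta> (birth (ivV i), death (ivV i)) (birth (ivW j), death (ivW j))"
    "bar_shift_le \<delta> (birth (ivW j), death (ivW j)) (birth (ivV i), death (ivV i))"
  using close[OF assms] mem_copies[OF assms]
  by (auto simp: V.birth_iv V.death_iv W.birth_iv W.death_iv)

lemma between:
  "(i, j) \<in> \<gamma> \<Longrightarrow> s \<in> ivV i \<Longrightarrow> t + \<epsilon> \<in> ivW j \<Longrightarrow> s \<le> t \<Longrightarrow> s + \<epsilon> \<in> ivW j \<and> t \<in> ivV i"
  using interval_shift_between[OF _ _ less bounds(1)] mem_copies V.iv_interval W.iv_interval by blast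

lemma mid: "(i, j) \<in> \<gamma> \<Longrightarrow> t \<in> ivV i \<Longrightarrow> t + 2 * \<epsilon> \<in> ivV i \<Longrightarrow> t + \<epsilon> \<in> ivW j"
  using interval_shift_mid[OF _ less bounds] mem_copies W.iv_interval by blast

lemma unmatched_shift:
  assumes "i \<in> copies BV - Domain \<gamma>" "t \<in> ivV i"
  shows "t + 2 * \<epsilon> \<notin> ivV i"
  using short_interval_shift[OF less _ assms(2)] short[OF assms(1)] assms(1)
  by (simp add: V.birth_iv V.death_iv)

text \<open>Bar \<open>j\<close> inherits the coordinate of its partner, which is unique as the
  converse of \<open>\<gamma>\<close> is single-valued. The cut-off outside \<open>ivW j\<close>
  makes \<open>W.vec\<close> applicable.\<close>

definition push :: "real \<Rightarrow> 'v \<Rightarrow> wbar \<times> nat \<Rightarrow> 'k" where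
  "push t x j = (if t + \<epsilon> \<in> ivW j \<and> (\<exists>i. (i, j) \<in> \<gamma>) then CV t x (THE i. (i, j) \<in> \<gamma>) else 0)"

definition \<Phi> :: "real \<Rightarrow> 'v \<Rightarrow> 'w" where
  "\<Phi> t x = W.vec (t + \<epsilon>) (push t x)"

lemma push_support: "push t x j \<noteq> 0 \<Longrightarrow> j \<in> copies BW \<and> t + \<epsilon> \<in> ivW j"
  using mem_copies unfolding push_def by meson

lemma \<Phi>_mem: "\<Phi> t x \<in> vsp W (t + \<epsilon>)"
  unfolding \<Phi>_def by (rule W.vec(1)) (rule push_support)

lemma C_\<Phi>_push: "CW (t + \<epsilon>) (\<Phi> t x) = push t x"
  unfolding \<Phi>_def by (rule W.vec(2)) (rule push_support)

lemma C_\<Phi>: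
  assumes "(i, j) \<in> \<gamma>"
  shows "CW (t + \<epsilon>) (\<Phi> t x) j = (if t + \<epsilon> \<in> ivW j then CV t x i else 0)"
proof -
  have "k = i" if "(k, j) \<in> \<gamma>" for k
    using that assms matching unfolding weighted_matching_def single_valued_def by blast
  then have "(THE k. (k, j) \<in> \<gamma>) = i" using assms by blast
  moreover have "\<exists>k. (k, j) \<in> \<gamma>" using assms by blast
  ultimately show ?thesis by (simp add: C_\<Phi>_push push_def del: split_paired_Ex)
qed

lemma C_\<Phi>_unmatched: "j \<notin> Range \<gamma> \<Longrightarrow> CW (t + \<epsilon>) (\<Phi> t x) j = 0"
  unfolding C_\<Phi>_push push_def by auto

lemma \<Phi>_eqI:
  assumes "y \<in> vsp W (t + \<epsilon>)"
    and "\<And>i j. (i, j) \<in> \<gamma> \<Longrightarrow> CW (t + \<epsilon>) y j = (if t + \<epsilon> \<in> ivW j then CV t x i else 0)"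
    and "\<And>j. j \<notin> Range \<gamma> \<Longrightarrow> CW (t + \<epsilon>) y j = 0"
  shows "\<Phi> t x = y"
proof (rule W.C_inject[OF \<Phi>_mem assms(1)])
  fix j
  show "CW (t + \<epsilon>) (\<Phi> t x) j = CW (t + \<epsilon>) y j"
    using assms(2,3) C_\<Phi> C_\<Phi>_unmatched by (cases "j \<in> Range \<gamma>") (metis RangeE)+
qed

lemma weighted_nat_trans_\<Phi>: "weighted_nat_trans V (shift \<epsilon> W) \<Phi>"
proof -
  have add: "\<Phi> t (x + y) = \<Phi> t x + \<Phi> t y" if "x \<in> vsp V t" "y \<in> vsp V t" for t x y
    by (rule \<Phi>_eqI)
      (simp_all add: W.C_add \<Phi>_mem W.subspace_add[OF W.vsp_subspace] V.C_add that C_\<Phi> C_\<Phi>_unmatched)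
  have scale: "\<Phi> t (scl V a x) = scl W a (\<Phi> t x)" if "x \<in> vsp V t" for t a x
    by (rule \<Phi>_eqI)
      (simp_all add: W.C_scale \<Phi>_mem W.subspace_scale[OF W.vsp_subspace] V.C_scale that C_\<Phi> C_\<Phi>_unmatched)
  have nat: "\<Phi> t (tmap V s t x) = tmap W (s + \<epsilon>) (t + \<epsilon>) (\<Phi> s x)"
    if st: "s \<le> t" and x: "x \<in> vsp V s" for s t x
  proof (rule \<Phi>_eqI)
    show "tmap W (s + \<epsilon>) (t + \<epsilon>) (\<Phi> s x) \<in> vsp W (t + \<epsilon>)"
      using st by (intro W.tmap_mem \<Phi>_mem) simp
    show "CW (t + \<epsilon>) (tmap W (s + \<epsilon>) (t + \<epsilon>) (\<Phi> s x)) j = 0" if "j \<notin> Range \<gamma>" for j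
      using st that by (simp add: W.C_tmap \<Phi>_mem C_\<Phi>_unmatched)
    \<comment> \<open>Let \<open>t + \<epsilon>\<close> be in \<open>ivW j\<close>. If
      \<open>CV s x i\<close> is nonzero, \<open>i\<close> is alive at \<open>s\<close> and
      \<open>between\<close> lets it pass both ways; if it is zero, so are both sides.\<close>
    show "CW (t + \<epsilon>) (tmap W (s + \<epsilon>) (t + \<epsilon>) (\<Phi> s x)) j =
        (if t + \<epsilon> \<in> ivW j then CV t (tmap V s t x) i else 0)" if ij: "(i, j) \<in> \<gamma>" for i j
      using st between[OF ij _ _ st] V.C_support[OF x, of i]
      by (simp add: W.C_tmap \<Phi>_mem V.C_tmap x C_\<Phi>[OF ij]) blast
  qed
  have grade: "\<Phi> t x \<in> grade W (t + \<epsilon>) w" if w: "0 \<le> w" and x: "x \<in> grade V t w" for t w x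
  proof -
    have "x \<in> vsp V t"
      using V.wpm w x unfolding weighted_persistence_module_def weighted_vector_space_def by blast
    then have *: "\<And>i. CV t x i \<noteq> 0 \<Longrightarrow> weight i = w" using V.C_grade[OF w] x by blast
    show ?thesis
      unfolding W.C_grade[OF w \<Phi>_mem]
    proof (intro allI impI)
      fix j assume nz: "CW (t + \<epsilon>) (\<Phi> t x) j \<noteq> 0"
      then obtain i where ij: "(i, j) \<in> \<gamma>" using C_\<Phi>_unmatched by blast
      then have "CV t x i \<noteq> 0" using nz C_\<Phi>[OF ij, of t x] by (simp split: if_splits)
      then show "weight j = w" using * weight_eq[OF ij] by simp
    qed
  qed
  show ?thesis
    unfolding weighted_nat_trans_def nat_trans_def linear_between_def shift_def
    using add scale nat grade \<Phi>_mem by (auto simp: image_subset_iff)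
qed

text \<open>\<open>y\<close> stands for the composite, whose second map belongs to the other
  interpretation of the locale; it enters through its coordinates. A matched coordinate passes the
  cut-off at \<open>t + \<epsilon>\<close> by \<open>mid\<close>; an unmatched one is killed by the
  structure map by \<open>unmatched_shift\<close>.\<close>

lemma eq_tmap_of_coordinates:
  assumes \<epsilon>: "0 \<le> \<epsilon>" and x: "x \<in> vsp V t"
    and y: "y \<in> vsp V (t + \<epsilon> + \<epsilon>)"
    and matched: "\<And>i j. (i, j) \<in> \<gamma> \<Longrightarrow>
      CV (t + \<epsilon> + \<epsilon>) y i = (if t + \<epsilon> + \<epsilon> \<in> ivV i then CW (t + \<epsilon>) (\<Phi> t x) j else 0)"
    and unmatched: "\<And>i. i \<notin> Domain \<gamma> \<Longrightarrow> CV (t + \<epsilon> + \<epsilon>) y i = 0"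
  shows "y = tmap V t (t + 2 * \<epsilon>) x"
proof -
  have *: "t + \<epsilon> + \<epsilon> = t + 2 * \<epsilon>" by simp
  note m = y matched unmatched
  note m = m[unfolded *]
  show ?thesis
  proof (rule V.C_inject)
    show "y \<in> vsp V (t + 2 * \<epsilon>)" by (rule m(1))
    show "tmap V t (t + 2 * \<epsilon>) x \<in> vsp V (t + 2 * \<epsilon>)" using \<epsilon> x by (intro V.tmap_mem) auto
    fix i
    have tm: "CV (t + 2 * \<epsilon>) (tmap V t (t + 2 * \<epsilon>) x) i = (if t + 2 * \<epsilon> \<in> ivV i then CV t x i else 0)"
      using \<epsilon> x by (simp add: V.C_tmap)
    show "CV (t + 2 * \<epsilon>) y i = CV (t + 2 * \<epsilon>) (tmap V t (t + 2 * \<epsilon>) x) i"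
    proof (cases "i \<in> Domain \<gamma>")
      case True
      then obtain j where ij: "(i, j) \<in> \<gamma>" by blast
      show ?thesis
        unfolding tm m(2)[OF ij] C_\<Phi>[OF ij] using mid[OF ij, of t] V.C_support[OF x, of i] by auto
    next
      case False
      then show ?thesis
        unfolding tm m(3)[OF False] using unmatched_shift[of i t] V.C_support[OF x, of i] by auto
    qed
  qed
qed

end

theorem interleaved_of_matching:
  assumes "bar_basis V BV ivV CV" "bar_basis W BW ivW CW"
    and \<gamma>: "weighted_matching BV BW \<gamma>" "matching_cost BV BW \<gamma> \<le> ennreal \<delta>"
    and \<delta>: "0 \<le> \<delta>" "\<delta> < \<epsilon>"
  shows "interleaved \<epsilon> V W"
proof -
  interpret V: bar_basis V BV ivV CV by fact
  interpret W: bar_basis W BW ivW CW by fact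
  have cost: "(\<forall>(i, j)\<in>\<gamma>. bar_shift_le \<delta> (bar i) (bar j) \<and> bar_shift_le \<delta> (bar j) (bar i)) \<and>
    (\<forall>i\<in>copies BV - Domain \<gamma>. snd (bar i) \<le> fst (bar i) + ereal (2 * \<delta>)) \<and>
    (\<forall>j\<in>copies BW - Range \<gamma>. snd (bar j) \<le> fst (bar j) + ereal (2 * \<delta>))"
    using \<gamma>(2) by (subst (asm) matching_cost_le_iff[OF \<delta>(1) V.proper_bar W.proper_bar])
  have conv: "weighted_matching BW BV (\<gamma>\<inverse>)"
    using \<gamma>(1) unfolding weighted_matching_def by fastforce
  interpret f: bar_basis_matching V BV ivV CV W BW ivW CW \<delta> \<epsilon> \<gamma>
    using \<gamma>(1) \<delta>(2) cost by unfold_locales blast+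
  interpret g: bar_basis_matching W BW ivW CW V BV ivV CV \<delta> \<epsilon> "\<gamma>\<inverse>"
    using conv \<delta>(2) cost by unfold_locales blast+
  have \<epsilon>: "0 \<le> \<epsilon>" using \<delta> by simp
  have "g.\<Phi> (t + \<epsilon>) (f.\<Phi> t x) = tmap V t (t + 2 * \<epsilon>) x" if "x \<in> vsp V t" for t x
  proof (rule f.eq_tmap_of_coordinates[OF \<epsilon> that g.\<Phi>_mem])
    show "CV (t + \<epsilon> + \<epsilon>) (g.\<Phi> (t + \<epsilon>) (f.\<Phi> t x)) i =
        (if t + \<epsilon> + \<epsilon> \<in> ivV i then CW (t + \<epsilon>) (f.\<Phi> t x) j else 0)" if "(i, j) \<in> \<gamma>" for i j
      using that by (intro g.C_\<Phi>) simp
    show "CV (t + \<epsilon> + \<epsilon>) (g.\<Phi> (t + \<epsilon>) (f.\<Phi> t x)) i = 0" if "i \<notin> Domain \<gamma>" for i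
      using that by (intro g.C_\<Phi>_unmatched) simp
  qed
  moreover have "f.\<Phi> (t + \<epsilon>) (g.\<Phi> t y) = tmap W t (t + 2 * \<epsilon>) y" if "y \<in> vsp W t" for t y
  proof (rule g.eq_tmap_of_coordinates[OF \<epsilon> that f.\<Phi>_mem])
    show "CW (t + \<epsilon> + \<epsilon>) (f.\<Phi> (t + \<epsilon>) (g.\<Phi> t y)) i =
        (if t + \<epsilon> + \<epsilon> \<in> ivW i then CV (t + \<epsilon>) (g.\<Phi> t y) j else 0)" if "(i, j) \<in> \<gamma>\<inverse>" for i j
      using that by (intro f.C_\<Phi>) simp
    show "CW (t + \<epsilon> + \<epsilon>) (f.\<Phi> (t + \<epsilon>) (g.\<Phi> t y)) i = 0" if "i \<notin> Domain (\<gamma>\<inverse>)" for i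
      using that by (intro f.C_\<Phi>_unmatched) simp
  qed
  ultimately show ?thesis
    unfolding interleaved_def using f.weighted_nat_trans_\<Phi> g.weighted_nat_trans_\<Phi> by blast
qed

section \<open>Bases adapted to barcodes\<close>

text \<open>Each \<open>e i\<close> lies outside the kernel of \<open>c i\<close>, a subspace that
  contains all other \<open>e j\<close>. So the \<open>e i\<close> are independent in a
  finite-dimensional space.\<close>

lemma finite_index_of_dual_functionals:
  fixes s :: "'k::field \<Rightarrow> 'v::ab_group_add \<Rightarrow> 'v" and c :: "'i \<Rightarrow> 'v \<Rightarrow> 'k"
  assumes vs: "vector_space s" and sub: "module.subspace s U" and fin: "finite A" "U = module.span s A"
    and e: "\<And>i. i \<in> I \<Longrightarrow> e i \<in> U"
    and add: "\<And>i x y. i \<in> I \<Longrightarrow> x \<in> U \<Longrightarrow> y \<in> U \<Longrightarrow> c i (x + y) = c i x + c i y"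
    and scale: "\<And>i a x. i \<in> I \<Longrightarrow> x \<in> U \<Longrightarrow> c i (s a x) = a * c i x"
    and dual: "\<And>i j. i \<in> I \<Longrightarrow> j \<in> I \<Longrightarrow> c i (e j) = (if i = j then 1 else 0)"
  shows "finite I"
proof -
  interpret vector_space s by (rule vs)
  have zero: "c i 0 = 0" if "i \<in> I" for i
    using scale[OF that, of 0 0] subspace_0[OF sub] by simp
  have inj: "inj_on e I"
  proof (rule inj_onI)
    fix i j assume "i \<in> I" "j \<in> I" "e i = e j"
    then show "i = j" using dual[of i i] dual[of i j] by (auto split: if_splits)
  qed
  have "independent (e ` I)"
    unfolding dependent_def
  proof
    assume "\<exists>a\<in>e ` I. a \<in> span (e ` I - {a})"
    then obtain i where i: "i \<in> I" "e i \<in> span (e ` I - {e i})" by blast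
    define K where "K = {x \<in> U. c i x = 0}"
    have "subspace K"
      using i(1) subspace_0[OF sub] subspace_add[OF sub] subspace_scale[OF sub]
      by (auto simp: subspace_def K_def zero add scale)
    moreover have "e ` I - {e i} \<subseteq> K"
      using i(1) e dual inj by (auto simp: K_def)
    ultimately have "e i \<in> K" using i(2) span_minimal by blast
    then show False using dual[OF i(1) i(1)] by (simp add: K_def)
  qed
  moreover have "e ` I \<subseteq> span A" using e fin(2) by auto
  ultimately have "finite (e ` I)" using independent_span_bound[OF fin(1)] by blast
  then show ?thesis using inj finite_image_iff by blast
qed

section \<open>Coordinates of ordinary persistence modules\<close>

text \<open>The unweighted analogue of \<open>bar_basis\<close>, over any index type. Elements of a
  direct sum have finite support, so \<open>c_surj\<close> asks for it; \<open>finite_bars\<close>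
  later makes it automatic, which gives the form of \<open>C_surj\<close>.\<close>

locale module_coordinates =
  fixes M :: "('k::field, 'v::ab_group_add, 'z) pmod_scheme" and I :: "'i set"
    and iv :: "'i \<Rightarrow> real set" and c :: "real \<Rightarrow> 'v \<Rightarrow> 'i \<Rightarrow> 'k"
  assumes pm: "persistence_module M"
    and c_support: "x \<in> vsp M t \<Longrightarrow> c t x i \<noteq> 0 \<Longrightarrow> i \<in> I \<and> t \<in> iv i"
    and c_add: "x \<in> vsp M t \<Longrightarrow> y \<in> vsp M t \<Longrightarrow> c t (x + y) i = c t x i + c t y i"
    and c_scale: "x \<in> vsp M t \<Longrightarrow> c t (scl M a x) i = a * c t x i"
    and c_inject: "x \<in> vsp M t \<Longrightarrow> y \<in> vsp M t \<Longrightarrow> (\<And>i. c t x i = c t y i) \<Longrightarrow> x = y"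
    and c_surj: "finite {i. f i \<noteq> 0} \<Longrightarrow> (\<And>i. f i \<noteq> 0 \<Longrightarrow> i \<in> I \<and> t \<in> iv i) \<Longrightarrow>
      \<exists>x\<in>vsp M t. c t x = f"
    and c_tmap: "s \<le> t \<Longrightarrow> x \<in> vsp M s \<Longrightarrow> c t (tmap M s t x) i = (if t \<in> iv i then c s x i else 0)"
begin

sublocale vector_space "scl M"
  using pm by (simp add: persistence_module_def)

lemma vsp_subspace: "subspace (vsp M t)"
  using pm by (simp add: persistence_module_def)

lemma c_zero: "c t 0 i = 0"
  using c_scale[of 0 t 0 i] subspace_0[OF vsp_subspace] by simp

lemma finite_bars:
  assumes "pointwise_finite_dim M"
  shows "finite {i \<in> I. t \<in> iv i}"
proof -
  let ?d = "\<lambda>i k. if k = i then 1 else 0 :: 'k"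
  obtain A where A: "finite A" "vsp M t = span A"
    using assms unfolding pointwise_finite_dim_def by blast
  have "\<exists>x\<in>vsp M t. c t x = ?d i" if "i \<in> {i \<in> I. t \<in> iv i}" for i
    using that by (intro c_surj) (auto split: if_splits)
  then obtain e where e: "\<And>i. i \<in> {i \<in> I. t \<in> iv i} \<Longrightarrow> e i \<in> vsp M t \<and> c t (e i) = ?d i"
    by metis
  show ?thesis
    by (rule finite_index_of_dual_functionals[OF vector_space_axioms vsp_subspace A,
          where e = e and c = "\<lambda>i x. c t x i"]) (use e in \<open>auto simp: c_add c_scale\<close>)
qed

lemma module_coordinates_reindex:
  assumes \<sigma>: "bij_betw \<sigma> I' I"
  shows "module_coordinates M I' (iv \<circ> \<sigma>) (\<lambda>t x i. if i \<in> I' then c t x (\<sigma> i) else 0)"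
proof
  show "persistence_module M" by (rule pm)
  show "x = y" if xy: "x \<in> vsp M t" "y \<in> vsp M t"
    and eq: "\<And>i. (if i \<in> I' then c t x (\<sigma> i) else 0) = (if i \<in> I' then c t y (\<sigma> i) else 0)" for t x y
  proof (rule c_inject[OF xy])
    fix i
    show "c t x i = c t y i"
    proof (cases "i \<in> I")
      case True
      then obtain i' where i': "i' \<in> I'" "i = \<sigma> i'" using \<sigma> by (auto simp: bij_betw_def)
      then show ?thesis using eq[of i'] by simp
    next
      case False
      then show ?thesis using c_support[OF xy(1), of i] c_support[OF xy(2), of i] by metis
    qed
  qed
  show "\<exists>x\<in>vsp M t. (\<lambda>i. if i \<in> I' then c t x (\<sigma> i) else 0) = f"
    if fin: "finite {i. f i \<noteq> 0}" and f: "\<And>i. f i \<noteq> 0 \<Longrightarrow> i \<in> I' \<and> t \<in> (iv \<circ> \<sigma>) i" for f t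
  proof -
    define g where "g i = (if i \<in> I then f (inv_into I' \<sigma> i) else 0)" for i
    have g: "g (\<sigma> i) = f i" if "i \<in> I'" for i
      using that \<sigma> by (auto simp: g_def bij_betw_def)
    have supp: "{i. g i \<noteq> 0} \<subseteq> \<sigma> ` {i. f i \<noteq> 0}"
      using \<sigma> by (auto simp: g_def bij_betw_def f_inv_into_f intro!: image_eqI split: if_splits)
    have "\<exists>x\<in>vsp M t. c t x = g"
    proof (rule c_surj)
      show "finite {i. g i \<noteq> 0}" using supp fin finite_surj by blast
      show "i \<in> I \<and> t \<in> iv i" if gi: "g i \<noteq> 0" for i
      proof -
        obtain k where "i = \<sigma> k" "f k \<noteq> 0" using gi supp by blast
        then show ?thesis using f[of k] \<sigma> by (auto simp: bij_betw_def)
      qed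
    qed
    then obtain x where "x \<in> vsp M t" "c t x = g" by blast
    moreover have "(\<lambda>i. if i \<in> I' then g (\<sigma> i) else 0) = f"
      using g f by (auto simp: fun_eq_iff)
    ultimately show ?thesis by auto
  qed
qed (use \<sigma> c_support in \<open>auto simp: c_add c_scale c_tmap bij_betw_def split: if_splits\<close>)

end

lemma interval_decomposition_coordinates:
  fixes M :: "('k::field, 'v::ab_group_add, 'z) pmod_scheme"
  assumes pm: "persistence_module M" and dec: "interval_decomposition M m"
  shows "\<exists>c. module_coordinates M (copies m) fst c"
proof -
  define D where "D = (direct_sum (copies m) (\<lambda>(J, k). interval_module J) :: ('k, real set \<times> nat \<Rightarrow>\<^sub>0 'k) pmod)"
  obtain \<theta> where nt: "nat_trans M D \<theta>" and bij: "\<And>r. bij_betw (\<theta> r) (vsp M r) (vsp D r)"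
    using dec unfolding interval_decomposition_def pmod_isomorphic_def D_def by blast
  have mem_D: "p \<in> vsp D r \<longleftrightarrow> (\<forall>i. Poly_Mapping.lookup p i \<noteq> 0 \<longrightarrow> i \<in> copies m \<and> r \<in> fst i)" for p r
  proof -
    have vsp: "x \<in> vsp ((case i of (J, k) \<Rightarrow> interval_module J) :: ('k, 'k) pmod) r \<longleftrightarrow> r \<in> fst i \<or> x = 0" for x i
      by (cases i) (simp add: interval_module_def)
    show ?thesis
      unfolding D_def direct_sum_def pmod.simps mem_Collect_eq vsp subset_iff in_keys_iff by blast
  qed
  have scl_D: "Poly_Mapping.lookup (scl D a p) i = a * Poly_Mapping.lookup p i" for a p i
    by (cases i) (simp add: D_def direct_sum_def mapp.rep_eq when_def in_keys_iff interval_module_def)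
  have tmap_D: "Poly_Mapping.lookup (tmap D r s p) i = (if s \<in> fst i then Poly_Mapping.lookup p i else 0)"
    if "p \<in> vsp D r" for p r s i
    using that unfolding mem_D
    by (cases i) (auto simp: D_def direct_sum_def mapp.rep_eq when_def in_keys_iff interval_module_def)
  have mem: "\<theta> t x \<in> vsp D t" if "x \<in> vsp M t" for t x
    using bij[of t] that by (auto simp: bij_betw_def)
  have lin: "linear_between (scl M) (vsp M t) (scl D) (vsp D t) (\<theta> t)" for t
    using nt by (simp add: nat_trans_def)
  have "module_coordinates M (copies m) fst (\<lambda>t x. Poly_Mapping.lookup (\<theta> t x))"
  proof
    show "persistence_module M" by (rule pm)
    show "i \<in> copies m \<and> t \<in> fst i" if "x \<in> vsp M t" "Poly_Mapping.lookup (\<theta> t x) i \<noteq> 0" for x t i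
      using mem[OF that(1)] that(2) unfolding mem_D by blast
    show "Poly_Mapping.lookup (\<theta> t (x + y)) i = Poly_Mapping.lookup (\<theta> t x) i + Poly_Mapping.lookup (\<theta> t y) i"
      if "x \<in> vsp M t" "y \<in> vsp M t" for x y t i
      using lin[of t] that by (simp add: linear_between_def lookup_add)
    show "Poly_Mapping.lookup (\<theta> t (scl M a x)) i = a * Poly_Mapping.lookup (\<theta> t x) i"
      if "x \<in> vsp M t" for x t a i
      using lin[of t] that by (simp add: linear_between_def scl_D)
    show "x = y" if "x \<in> vsp M t" "y \<in> vsp M t"
      "\<And>i. Poly_Mapping.lookup (\<theta> t x) i = Poly_Mapping.lookup (\<theta> t y) i" for x y t
      using bij[of t] that poly_mapping_eqI[of "\<theta> t x" "\<theta> t y"] by (auto simp: bij_betw_def dest: inj_onD)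
    show "\<exists>x\<in>vsp M t. Poly_Mapping.lookup (\<theta> t x) = f"
      if "finite {i. f i \<noteq> 0}" "\<And>i. f i \<noteq> 0 \<Longrightarrow> i \<in> copies m \<and> t \<in> fst i" for f t
    proof -
      have f: "Poly_Mapping.lookup (Abs_poly_mapping f) = f" using that(1) by simp
      then have "Abs_poly_mapping f \<in> vsp D t" unfolding mem_D using that(2) by simp
      then show ?thesis using bij[of t] f by (force simp: bij_betw_def)
    qed
    show "Poly_Mapping.lookup (\<theta> t (tmap M s t x)) i = (if t \<in> fst i then Poly_Mapping.lookup (\<theta> s x) i else 0)"
      if "s \<le> t" "x \<in> vsp M s" for s t x i
      using nt that tmap_D[OF mem[OF that(2)]] by (simp add: nat_trans_def)
  qed
  then show ?thesis by blast
qed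

text \<open>Any point strictly between distinct endpoints will do; equal endpoints force a
  singleton. By finite dimension at the common \<open>t\<close>, only finitely many intervals share
  their endpoints, so that \<open>card\<close> in \<open>is_barcode\<close> really counts them
  instead of defaulting to 0.\<close>

lemma bars_with_endpoints_meet:
  assumes b: "birth J = b" "death J = d" "J \<noteq> {}"
  shows "\<exists>t. \<forall>K. is_interval K \<longrightarrow> K \<noteq> {} \<longrightarrow> birth K = b \<longrightarrow> death K = d \<longrightarrow> t \<in> K"
proof (cases "b < d")
  case True
  then obtain t where "b < ereal t" "ereal t < d" using ereal_dense2 by blast
  then show ?thesis using birth_less_less_death_imp_mem by blast
next
  case False
  have between: "birth K \<le> ereal t \<and> ereal t \<le> death K" if "t \<in> K" for t K
    using that unfolding birth_def death_def by (auto intro: INF_lower SUP_upper)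
  obtain t where t: "t \<in> J" using b(3) by blast
  have td: "b = ereal t" "d = ereal t" using False between[OF t] b by auto
  have "t \<in> K" if K: "K \<noteq> {}" "birth K = b" "death K = d" for K
  proof -
    obtain u where "u \<in> K" using K(1) by blast
    moreover from this have "u = t" using between[of u K] K td by simp
    ultimately show ?thesis by simp
  qed
  then show ?thesis by blast
qed

lemma barcode_coordinates:
  fixes M :: "('k::field, 'v::ab_group_add, 'z) pmod_scheme"
  assumes pm: "persistence_module M" and pfd: "pointwise_finite_dim M" and bc: "is_barcode M \<beta>"
  shows "\<exists>iv c. module_coordinates M (copies \<beta>) iv c \<and>
    (\<forall>i\<in>copies \<beta>. is_interval (iv i) \<and> iv i \<noteq> {} \<and> birth (iv i) = fst (fst i) \<and> death (iv i) = snd (fst i))"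
proof -
  obtain m where dec: "interval_decomposition M m"
    and \<beta>: "\<And>b d. \<beta> (b, d) = card {(J, k) \<in> copies m. birth J = b \<and> death J = d}"
    using bc unfolding is_barcode_def by blast
  obtain c where "module_coordinates M (copies m) fst c"
    using interval_decomposition_coordinates[OF pm dec] by blast
  then interpret module_coordinates M "copies m" fst c .
  have iv: "is_interval (fst i)" "fst i \<noteq> {}" if "i \<in> copies m" for i
    using that dec by (auto simp: interval_decomposition_def copies_def)
  define S where "S x = {i \<in> copies m. (birth (fst i), death (fst i)) = x}" for x
  have S: "\<beta> x = card (S x)" for x
    using \<beta>[of "fst x" "snd x"] by (auto simp: S_def intro!: arg_cong[of _ _ card])
  have fin: "finite (S x)" for x
  proof (cases "S x = {}")
    case False
    then obtain i where i: "i \<in> S x" by blast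
    then have "i \<in> copies m" "birth (fst i) = fst x" "death (fst i) = snd x" by (auto simp: S_def)
    then obtain t where t: "\<And>K. is_interval K \<Longrightarrow> K \<noteq> {} \<Longrightarrow> birth K = fst x \<Longrightarrow> death K = snd x \<Longrightarrow> t \<in> K"
      using bars_with_endpoints_meet[of "fst i" "fst x" "snd x"] iv(2)[of i] by blast
    have "S x \<subseteq> {i \<in> copies m. t \<in> fst i}"
    proof
      fix i assume i: "i \<in> S x"
      then show "i \<in> {i \<in> copies m. t \<in> fst i}" using t[of "fst i"] iv[of i] by (auto simp: S_def)
    qed
    then show ?thesis using finite_bars[OF pfd] finite_subset by blast
  qed simp
  have "\<exists>h. bij_betw h {0..<\<beta> x} (S x)" for x
    unfolding S by (rule ex_bij_betw_nat_finite[OF fin])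
  then obtain h where h: "\<And>x. bij_betw (h x) {0..<\<beta> x} (S x)" by metis
  \<comment> \<open>\<open>S x\<close> is numbered by the naturals below \<open>\<beta> x\<close>,
    so the copy number \<open>snd i\<close> picks one of the intervals with endpoints
    \<open>fst i\<close>.\<close>
  define \<sigma> where "\<sigma> i = h (fst i) (snd i)" for i
  have \<sigma>_S: "\<sigma> i \<in> S (fst i)" if "i \<in> copies \<beta>" for i
    using that h[of "fst i"] by (auto simp: \<sigma>_def copies_def bij_betw_def)
  have "bij_betw \<sigma> (copies \<beta>) (copies m)"
    unfolding bij_betw_def
  proof
    show "inj_on \<sigma> (copies \<beta>)"
    proof (rule inj_onI)
      fix i j assume ij: "i \<in> copies \<beta>" "j \<in> copies \<beta>" "\<sigma> i = \<sigma> j"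
      then have "fst i = fst j" using \<sigma>_S[of i] \<sigma>_S[of j] by (auto simp: S_def)
      moreover from this have "snd i = snd j"
        using ij h[of "fst i"] by (auto simp: \<sigma>_def copies_def bij_betw_def dest: inj_onD)
      ultimately show "i = j" by (simp add: prod_eq_iff)
    qed
    show "\<sigma> ` copies \<beta> = copies m"
    proof
      show "\<sigma> ` copies \<beta> \<subseteq> copies m" using \<sigma>_S by (auto simp: S_def)
      show "copies m \<subseteq> \<sigma> ` copies \<beta>"
      proof
        fix i assume "i \<in> copies m"
        define x where "x = (birth (fst i), death (fst i))"
        have "i \<in> h x ` {0..<\<beta> x}"
          using \<open>i \<in> copies m\<close> h[of x] by (simp add: S_def x_def bij_betw_def)
        then obtain k where "k < \<beta> x" "i = h x k" by auto
        then show "i \<in> \<sigma> ` copies \<beta>" by (auto simp: \<sigma>_def copies_def intro!: image_eqI[of _ _ "(x, k)"])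
      qed
    qed
  qed
  then have "module_coordinates M (copies \<beta>) (fst \<circ> \<sigma>) (\<lambda>t x i. if i \<in> copies \<beta> then c t x (\<sigma> i) else 0)"
    by (rule module_coordinates_reindex)
  moreover have "is_interval ((fst \<circ> \<sigma>) i) \<and> (fst \<circ> \<sigma>) i \<noteq> {} \<and> birth ((fst \<circ> \<sigma>) i) = fst (fst i) \<and>
      death ((fst \<circ> \<sigma>) i) = snd (fst i)" if "i \<in> copies \<beta>" for i
    using \<sigma>_S[OF that] iv[of "\<sigma> i"] by (simp add: S_def prod_eq_iff)
  ultimately show ?thesis by blast
qed

lemma pointwise_finite_dim_weight_component:
  assumes V: "weighted_persistence_module V" and pfd: "pointwise_finite_dim V" and w: "0 \<le> w"
  shows "pointwise_finite_dim (weight_component V w)"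
  unfolding pointwise_finite_dim_def
proof
  fix r
  interpret vector_space "scl V"
    using V by (simp add: weighted_persistence_module_def persistence_module_def)
  have sub: "subspace (grade V r w)" "grade V r w \<subseteq> vsp V r"
    using V w unfolding weighted_persistence_module_def weighted_vector_space_def by auto
  obtain A where A: "finite A" "vsp V r = span A"
    using pfd unfolding pointwise_finite_dim_def by blast
  obtain E where E: "E \<subseteq> grade V r w" "independent E" "grade V r w \<subseteq> span E"
    using maximal_independent_subset[of "grade V r w"] by metis
  have "finite E" using independent_span_bound[OF A(1) E(2)] E(1) sub(2) A(2) by auto
  moreover have "grade V r w = span E" using E(1,3) sub(1) span_minimal by blast
  ultimately show "\<exists>E. finite E \<and> vsp (weight_component V w) r = module.span (scl (weight_component V w)) E"
    by (auto simp: weight_component_def)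
qed

section \<open>Components of a weighted module by weight\<close>

text \<open>The direct sum decomposition with plain functions: \<open>K x w\<close> is the component
  of \<open>x\<close> of weight \<open>w\<close>. The second conjunct is uniqueness, in the form
  that evaluates \<open>K\<close> on a sum of homogeneous vectors.\<close>

definition weight_projections :: "'v::ab_group_add set \<Rightarrow> (real \<Rightarrow> 'v set) \<Rightarrow> ('v \<Rightarrow> real \<Rightarrow> 'v) \<Rightarrow> bool" where
  "weight_projections U G K \<longleftrightarrow>
     (\<forall>x\<in>U. finite {w. K x w \<noteq> 0} \<and> (\<forall>w. K x w \<noteq> 0 \<longrightarrow> 0 \<le> w) \<and> (\<forall>w\<ge>0. K x w \<in> G w) \<and>
       x = (\<Sum>w\<in>{w. K x w \<noteq> 0}. K x w)) \<and>
     (\<forall>f. finite {w. f w \<noteq> 0} \<longrightarrow> (\<forall>w. f w \<noteq> 0 \<longrightarrow> 0 \<le> w) \<longrightarrow> (\<forall>w\<ge>0. f w \<in> G w) \<longrightarrow>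
       (\<Sum>w\<in>{w. f w \<noteq> 0}. f w) \<in> U \<longrightarrow> K (\<Sum>w\<in>{w. f w \<noteq> 0}. f w) = f)"

lemma ex_weight_projections:
  assumes "weighted_vector_space s U G"
  shows "\<exists>K. weight_projections U G K"
proof -
  define P where "P x c \<longleftrightarrow> Poly_Mapping.keys c \<subseteq> {0..} \<and> (\<forall>w\<ge>0. Poly_Mapping.lookup c w \<in> G w) \<and>
    x = (\<Sum>w\<in>Poly_Mapping.keys c. Poly_Mapping.lookup c w)" for x and c :: "real \<Rightarrow>\<^sub>0 'b"
  have ex1: "\<exists>!c. P x c" if "x \<in> U" for x
    using assms that unfolding weighted_vector_space_def P_def by blast
  define K where "K x = Poly_Mapping.lookup (THE c. P x c)" for x
  have keys: "{w. Poly_Mapping.lookup c w \<noteq> 0} = Poly_Mapping.keys c" for c :: "real \<Rightarrow>\<^sub>0 'b"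
    by (auto simp: in_keys_iff)
  have "finite {w. K x w \<noteq> 0} \<and> (\<forall>w. K x w \<noteq> 0 \<longrightarrow> 0 \<le> w) \<and> (\<forall>w\<ge>0. K x w \<in> G w) \<and>
       x = (\<Sum>w\<in>{w. K x w \<noteq> 0}. K x w)" if "x \<in> U" for x
    using theI'[OF ex1[OF that]] unfolding K_def P_def keys by (auto simp: in_keys_iff)
  moreover have "K (\<Sum>w\<in>{w. f w \<noteq> 0}. f w) = f"
    if f: "finite {w. f w \<noteq> 0}" "\<forall>w. f w \<noteq> 0 \<longrightarrow> 0 \<le> w" "\<forall>w\<ge>0. f w \<in> G w"
      and U: "(\<Sum>w\<in>{w. f w \<noteq> 0}. f w) \<in> U" for f
  proof -
    have l: "Poly_Mapping.lookup (Abs_poly_mapping f) = f" using f(1) by simp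
    then have k: "Poly_Mapping.keys (Abs_poly_mapping f) = {w. f w \<noteq> 0}" using keys by metis
    have "P (\<Sum>w\<in>{w. f w \<noteq> 0}. f w) (Abs_poly_mapping f)"
      unfolding P_def k l using f by auto
    then show ?thesis using the1_equality[OF ex1[OF U]] l by (simp add: K_def)
  qed
  ultimately show ?thesis unfolding weight_projections_def by blast
qed

locale weighted_module =
  fixes V :: "('k::field, 'v::ab_group_add) wpmod" and K :: "real \<Rightarrow> 'v \<Rightarrow> real \<Rightarrow> 'v"
  assumes wpm: "weighted_persistence_module V"
    and projections: "\<And>t. weight_projections (vsp V t) (grade V t) (K t)"
begin

lemma pm: "persistence_module V"
  using wpm by (simp add: weighted_persistence_module_def)

sublocale vector_space "scl V"
  using pm by (simp add: persistence_module_def)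

lemma vsp_subspace: "subspace (vsp V t)"
  using pm by (simp add: persistence_module_def)

lemma grade_subspace: "0 \<le> w \<Longrightarrow> subspace (grade V t w)"
  and grade_subset: "0 \<le> w \<Longrightarrow> x \<in> grade V t w \<Longrightarrow> x \<in> vsp V t"
  using wpm unfolding weighted_persistence_module_def weighted_vector_space_def by blast+

lemma tmap_grade: "s \<le> t \<Longrightarrow> 0 \<le> w \<Longrightarrow> x \<in> grade V s w \<Longrightarrow> tmap V s t x \<in> grade V t w"
  using wpm unfolding weighted_persistence_module_def by blast

lemma tmap_add: "s \<le> t \<Longrightarrow> x \<in> vsp V s \<Longrightarrow> y \<in> vsp V s \<Longrightarrow> tmap V s t (x + y) = tmap V s t x + tmap V s t y"
  and tmap_scale: "s \<le> t \<Longrightarrow> x \<in> vsp V s \<Longrightarrow> tmap V s t (scl V a x) = scl V a (tmap V s t x)"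
  using pm unfolding persistence_module_def linear_between_def by blast+

lemma tmap_zero: "s \<le> t \<Longrightarrow> tmap V s t 0 = 0"
  using tmap_scale[of s t 0 0] subspace_0[OF vsp_subspace] by simp

lemma tmap_sum:
  "finite A \<Longrightarrow> s \<le> t \<Longrightarrow> (\<And>a. a \<in> A \<Longrightarrow> f a \<in> vsp V s) \<Longrightarrow> tmap V s t (sum f A) = (\<Sum>a\<in>A. tmap V s t (f a))"
proof (induction A rule: finite_induct)
  case (insert a A)
  then have "sum f A \<in> vsp V s" by (intro subspace_sum[OF vsp_subspace]) auto
  then show ?case using insert by (simp add: tmap_add)
qed (simp add: tmap_zero)

context
  fixes t x assumes x: "x \<in> vsp V t"
begin

lemma finite_K: "finite {w. K t x w \<noteq> 0}"
  and K_neg: "w < 0 \<Longrightarrow> K t x w = 0"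
  and K_grade: "0 \<le> w \<Longrightarrow> K t x w \<in> grade V t w"
  and sum_K: "(\<Sum>w\<in>{w. K t x w \<noteq> 0}. K t x w) = x"
  using projections[of t] x unfolding weight_projections_def by (force simp: not_le[symmetric])+

lemma K_mem: "K t x w \<in> vsp V t"
  using grade_subset[OF _ K_grade] K_neg subspace_0[OF vsp_subspace] by (cases "0 \<le> w") auto

lemma sum_K_superset:
  assumes "finite A" "{w. K t x w \<noteq> 0} \<subseteq> A"
  shows "(\<Sum>w\<in>A. K t x w) = x"
proof -
  have "(\<Sum>w\<in>A. K t x w) = (\<Sum>w\<in>{w. K t x w \<noteq> 0}. K t x w)"
    using assms by (intro sum.mono_neutral_right) auto
  also have "\<dots> = x" by (rule sum_K)
  finally show ?thesis .
qed

end

text \<open>The way to compute components: write the vector as the sum of a guessed homogeneous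
  family. Linearity and naturality of \<open>K\<close> follow from it.\<close>

lemma K_unique:
  assumes A: "finite A" "\<And>w. f w \<noteq> 0 \<Longrightarrow> w \<in> A" and f: "\<And>w. w < 0 \<Longrightarrow> f w = 0"
    "\<And>w. 0 \<le> w \<Longrightarrow> f w \<in> grade V t w"
  shows "sum f A \<in> vsp V t" "K t (sum f A) = f"
proof -
  have "f w \<in> vsp V t" for w
    using f grade_subset subspace_0[OF vsp_subspace] by (cases "0 \<le> w") auto
  then show mem: "sum f A \<in> vsp V t" by (intro subspace_sum[OF vsp_subspace])
  have "sum f A = (\<Sum>w\<in>{w. f w \<noteq> 0}. f w)"
    using A by (intro sum.mono_neutral_right) auto
  moreover have "finite {w. f w \<noteq> 0}" using A finite_subset[of "{w. f w \<noteq> 0}" A] by auto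
  moreover have "\<forall>w. f w \<noteq> 0 \<longrightarrow> 0 \<le> w" using f(1) not_le by blast
  ultimately show "K t (sum f A) = f"
    using projections[of t] f(2) mem unfolding weight_projections_def by metis
qed

lemma K_add:
  assumes "x \<in> vsp V t" "y \<in> vsp V t"
  shows "K t (x + y) w = K t x w + K t y w"
proof -
  let ?A = "{w. K t x w \<noteq> 0} \<union> {w. K t y w \<noteq> 0}"
  have "K t (\<Sum>w\<in>?A. K t x w + K t y w) = (\<lambda>w. K t x w + K t y w)"
    using assms by (intro K_unique(2)) (auto simp: finite_K K_neg intro: subspace_add[OF grade_subspace] K_grade)
  then show ?thesis
    using assms by (simp add: sum.distrib sum_K_superset finite_K)
qed

lemma K_scale:
  assumes "x \<in> vsp V t"
  shows "K t (scl V a x) w = scl V a (K t x w)"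
proof -
  have "K t (\<Sum>w\<in>{w. K t x w \<noteq> 0}. scl V a (K t x w)) = (\<lambda>w. scl V a (K t x w))"
    using assms by (intro K_unique(2)) (auto simp: finite_K K_neg intro: subspace_scale[OF grade_subspace] K_grade)
  then show ?thesis
    using assms by (simp add: scale_sum_right[symmetric] sum_K)
qed

lemma K_tmap:
  assumes "s \<le> t" "x \<in> vsp V s"
  shows "K t (tmap V s t x) w = tmap V s t (K s x w)"
proof -
  have "K t (\<Sum>w\<in>{w. K s x w \<noteq> 0}. tmap V s t (K s x w)) = (\<lambda>w. tmap V s t (K s x w))"
    using assms by (intro K_unique(2)) (auto simp: finite_K K_neg tmap_zero K_grade intro: tmap_grade)
  then show ?thesis
    using assms by (simp add: tmap_sum[symmetric] finite_K K_mem sum_K)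
qed

lemma K_homogeneous:
  assumes "0 \<le> w" "x \<in> grade V t w"
  shows "K t x u = (if u = w then x else 0)"
proof -
  have "K t (\<Sum>u\<in>{w}. if u = w then x else 0) = (\<lambda>u. if u = w then x else 0)"
    using assms subspace_0[OF grade_subspace] by (intro K_unique(2)) (auto split: if_splits)
  then show ?thesis by simp
qed

lemma grade_iff:
  assumes w: "0 \<le> w" and x: "x \<in> vsp V t"
  shows "x \<in> grade V t w \<longleftrightarrow> (\<forall>u. K t x u \<noteq> 0 \<longrightarrow> u = w)"
proof
  assume "x \<in> grade V t w"
  then show "\<forall>u. K t x u \<noteq> 0 \<longrightarrow> u = w" using K_homogeneous[OF w] by metis
next
  assume *: "\<forall>u. K t x u \<noteq> 0 \<longrightarrow> u = w"
  then have "{u. K t x u \<noteq> 0} \<subseteq> {w}" by blast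
  then have "x = K t x w" using sum_K_superset[OF x, of "{w}"] by simp
  then show "x \<in> grade V t w" using K_grade[OF x w] by simp
qed

end

text \<open>The coordinate of \<open>x\<close> at a bar of weight \<open>w\<close> is that of its
  component \<open>K t x w\<close> in a basis of \<open>weight_component V w\<close>. Finitely many
  bars of all weights together are alive at one parameter because \<open>V\<close> itself, and not
  only each component, is pointwise finite-dimensional.\<close>

theorem ex_bar_basis:
  fixes V :: "('k::field, 'v::ab_group_add) wpmod"
  assumes wpm: "weighted_persistence_module V" and pfd: "pointwise_finite_dim V"
    and bc: "is_weighted_barcode V B"
  shows "\<exists>iv C. bar_basis V B iv C"
proof -
  have "\<forall>t. \<exists>K. weight_projections (vsp V t) (grade V t) K"
    using wpm ex_weight_projections unfolding weighted_persistence_module_def by blast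
  then obtain K where "\<And>t. weight_projections (vsp V t) (grade V t) (K t)" by metis
  then interpret weighted_module V K using wpm by unfold_locales
  define Bw where "Bw w = (\<lambda>bd. B (bd, w))" for w
  have copies: "i \<in> copies B \<longleftrightarrow> 0 \<le> weight i \<and> (bar i, snd i) \<in> copies (Bw (weight i))" for i
  proof -
    have "B (fst i) = 0" if "weight i < 0"
      using bc that unfolding is_weighted_barcode_def by (metis prod.collapse)
    then have "0 \<le> weight i" if "i \<in> copies B"
      using that by (cases "weight i < 0") (auto simp: copies_def)
    then show ?thesis by (cases i) (auto simp: copies_def Bw_def)
  qed
  have "\<exists>iv c. 0 \<le> w \<longrightarrow> module_coordinates (weight_component V w) (copies (Bw w)) iv c \<and>
    (\<forall>i\<in>copies (Bw w). is_interval (iv i) \<and> iv i \<noteq> {} \<and> birth (iv i) = fst (fst i) \<and> death (iv i) = snd (fst i))"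
    for w
    using barcode_coordinates[OF persistence_module_weight_component[OF wpm]
        pointwise_finite_dim_weight_component[OF wpm pfd]] bc
    unfolding is_weighted_barcode_def Bw_def by blast
  then obtain ivw cw where
    mc: "\<And>w. 0 \<le> w \<Longrightarrow> module_coordinates (weight_component V w) (copies (Bw w)) (ivw w) (cw w)"
    and ivw: "\<And>w i. 0 \<le> w \<Longrightarrow> i \<in> copies (Bw w) \<Longrightarrow> is_interval (ivw w i) \<and> ivw w i \<noteq> {} \<and>
      birth (ivw w i) = fst (fst i) \<and> death (ivw w i) = snd (fst i)"
    by metis
  note mcs = module_coordinates.c_support[OF mc] module_coordinates.c_add[OF mc]
    module_coordinates.c_scale[OF mc] module_coordinates.c_inject[OF mc]
    module_coordinates.c_surj[OF mc] module_coordinates.c_tmap[OF mc] module_coordinates.c_zero[OF mc]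
  note mcs = mcs[unfolded weight_component_def pmod.simps]
  define iv where "iv i = ivw (weight i) (bar i, snd i)" for i
  define C where "C t x i = (if 0 \<le> weight i then cw (weight i) t (K t x (weight i)) (bar i, snd i) else 0)"
    for t x i
  have C_eq: "K t x w = K t y w"
    if xy: "x \<in> vsp V t" "y \<in> vsp V t" and eq: "\<And>i. weight i = w \<Longrightarrow> C t x i = C t y i" for t x y w
  proof (cases "0 \<le> w")
    case True
    have "cw w t (K t x w) i = cw w t (K t y w) i" for i
      using eq[of "((fst i, w), snd i)"] True by (simp add: C_def)
    then show ?thesis using mcs(4)[OF True K_grade[OF xy(1) True] K_grade[OF xy(2) True]] by blast
  next
    case False
    then show ?thesis using K_neg xy by simp
  qed
  have C_zero: "C t 0 i = 0" for t i
    using K_homogeneous[of "weight i" 0 t "weight i"] subspace_0[OF grade_subspace] mcs(7)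
    by (simp add: C_def)
  have K_zero: "K t 0 w = 0" for t w
    using K_scale[of 0 t 0 w] subspace_0[OF vsp_subspace] by simp
  interpret coords: module_coordinates V "copies B" iv C
  proof
    show "persistence_module V" by (rule pm)
    show "i \<in> copies B \<and> t \<in> iv i" if x: "x \<in> vsp V t" and nz: "C t x i \<noteq> 0" for x t i
    proof -
      have w: "0 \<le> weight i" using nz by (simp add: C_def split: if_splits)
      have "cw (weight i) t (K t x (weight i)) (bar i, snd i) \<noteq> 0" using nz w by (simp add: C_def)
      then show ?thesis
        using mcs(1)[OF w K_grade[OF x w]] w unfolding copies[of i] iv_def by blast
    qed
    show "C t (x + y) i = C t x i + C t y i" if "x \<in> vsp V t" "y \<in> vsp V t" for x y t i
      using that by (simp add: C_def K_add mcs(2) K_grade)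
    show "C t (scl V a x) i = a * C t x i" if "x \<in> vsp V t" for x t a i
      using that by (simp add: C_def K_scale mcs(3) K_grade)
    show "x = y" if "x \<in> vsp V t" "y \<in> vsp V t" "\<And>i. C t x i = C t y i" for x y t
    proof -
      have "K t x = K t y" using C_eq[OF that(1,2)] that(3) by (simp add: fun_eq_iff)
      then show ?thesis by (metis sum_K that(1,2))
    qed
    show "\<exists>x\<in>vsp V t. C t x = f"
      if fin: "finite {i. f i \<noteq> 0}" and f: "\<And>i. f i \<noteq> 0 \<Longrightarrow> i \<in> copies B \<and> t \<in> iv i" for f t
    proof -
      \<comment> \<open>The prescribed coordinates are split by weight; preimages \<open>y w\<close>
        in the graded pieces are then added over the finite set \<open>A\<close> of weights that
        occur.\<close>
      define fw where "fw w i = f ((fst i, w), snd i)" for w i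
      have "\<exists>x\<in>grade V t w. cw w t x = fw w" if w: "0 \<le> w" for w
      proof (rule mcs(5)[OF w])
        have "{i. fw w i \<noteq> 0} \<subseteq> (\<lambda>i. (bar i, snd i)) ` {i. f i \<noteq> 0}"
        proof
          fix i assume "i \<in> {i. fw w i \<noteq> 0}"
          then show "i \<in> (\<lambda>i. (bar i, snd i)) ` {i. f i \<noteq> 0}"
            by (intro image_eqI[of _ _ "((fst i, w), snd i)"]) (auto simp: fw_def)
        qed
        then show "finite {i. fw w i \<noteq> 0}" using fin finite_surj by blast
        show "i \<in> copies (Bw w) \<and> t \<in> ivw w i" if "fw w i \<noteq> 0" for i
          using that f[of "((fst i, w), snd i)"] unfolding fw_def copies iv_def by simp
      qed
      then obtain y where y: "\<And>w. 0 \<le> w \<Longrightarrow> y w \<in> grade V t w" "\<And>w. 0 \<le> w \<Longrightarrow> cw w t (y w) = fw w"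
        by metis
      define A where "A = weight ` {i. f i \<noteq> 0}"
      define z where "z w = (if 0 \<le> w then y w else 0)" for w
      \<comment> \<open>\<open>y w\<close> was chosen by its coordinates only; where these are all
        zero, their injectivity gives \<open>y w = 0\<close>.\<close>
      have zA: "w \<in> A" if "z w \<noteq> 0" for w
      proof (rule ccontr)
        assume "w \<notin> A"
        have w: "0 \<le> w" using that by (simp add: z_def split: if_splits)
        have "fw w i = 0" for i
        proof (rule ccontr)
          assume "fw w i \<noteq> 0"
          then have "w \<in> A"
            unfolding A_def by (intro image_eqI[of _ _ "((fst i, w), snd i)"]) (auto simp: fw_def)
          then show False using \<open>w \<notin> A\<close> by blast
        qed
        then have "cw w t (y w) i = cw w t 0 i" for i
          using y(2)[OF w] mcs(7)[OF w] by simp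
        then have "y w = 0" using mcs(4)[OF w y(1)[OF w] subspace_0[OF grade_subspace[OF w]]] by blast
        then show False using that w by (simp add: z_def)
      qed
      have z: "sum z A \<in> vsp V t" "K t (sum z A) = z"
        using fin zA y(1) by (intro K_unique; auto simp: A_def z_def)+
      moreover have "C t (sum z A) = f"
      proof
        fix i
        have "f i = 0" if "weight i < 0" using f[of i] that unfolding copies by auto
        then show "C t (sum z A) i = f i"
          unfolding C_def z(2) by (cases "0 \<le> weight i") (auto simp: z_def y(2) fw_def)
      qed
      ultimately show ?thesis by blast
    qed
    show "C t (tmap V s t x) i = (if t \<in> iv i then C s x i else 0)" if "s \<le> t" "x \<in> vsp V s" for s t x i
      using that by (simp add: C_def K_tmap mcs(6) K_grade iv_def)
  qed
  have "bar_basis V B iv C"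
  proof
    show "weighted_persistence_module V" by (rule wpm)
    fix i assume i: "i \<in> copies B"
    show "0 \<le> weight i" using i copies by blast
    show "is_interval (iv i)" "iv i \<noteq> {}" "birth (iv i) = fst (bar i)" "death (iv i) = snd (bar i)"
      using i ivw[of "weight i" "(bar i, snd i)"] unfolding copies iv_def by simp_all
  next
    show fin: "finite {i \<in> copies B. t \<in> iv i}" for t by (rule coords.finite_bars[OF pfd])
    show "\<exists>x\<in>vsp V t. C t x = f" if "\<And>i. f i \<noteq> 0 \<Longrightarrow> i \<in> copies B \<and> t \<in> iv i" for f t
    proof (rule coords.c_surj[OF _ that])
      show "finite {i. f i \<noteq> 0}"
        by (rule finite_subset[OF _ fin[of t]]) (use that in blast)
    qed
    show "x \<in> grade V t w \<longleftrightarrow> (\<forall>i. C t x i \<noteq> 0 \<longrightarrow> weight i = w)" if w: "0 \<le> w" and x: "x \<in> vsp V t" for w x t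
      unfolding grade_iff[OF w x]
    proof
      assume *: "\<forall>u. K t x u \<noteq> 0 \<longrightarrow> u = w"
      show "\<forall>i. C t x i \<noteq> 0 \<longrightarrow> weight i = w"
      proof (intro allI impI, rule ccontr)
        fix i assume i: "C t x i \<noteq> 0" "weight i \<noteq> w"
        then have "K t x (weight i) = 0" using * by blast
        then have "C t x i = C t 0 i" by (simp add: C_def K_zero)
        then show False using i(1) C_zero by simp
      qed
    next
      assume *: "\<forall>i. C t x i \<noteq> 0 \<longrightarrow> weight i = w"
      show "\<forall>u. K t x u \<noteq> 0 \<longrightarrow> u = w"
      proof (intro allI impI, rule ccontr)
        fix u assume u: "K t x u \<noteq> 0" "u \<noteq> w"
        have "K t x u = K t 0 u"
          using * u(2) C_zero by (intro C_eq x subspace_0[OF vsp_subspace]) metis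
        then show False using u(1) K_zero by simp
      qed
    qed
  qed (use coords.c_support coords.c_add coords.c_scale coords.c_inject coords.c_tmap in blast)+
  then show ?thesis by blast
qed

theorem theorem1p2:
  fixes V :: "('k::field, 'v::ab_group_add) wpmod"
    and W :: "('k, 'w::ab_group_add) wpmod"
    and B\<^sub>V B\<^sub>W :: "wbar \<Rightarrow> nat"
  assumes "weighted_persistence_module V" and "pointwise_finite_dim V"
    and "weighted_persistence_module W" and "pointwise_finite_dim W"
    and "is_weighted_barcode V B\<^sub>V"
    and "is_weighted_barcode W B\<^sub>W"
  shows "bottleneck_distance B\<^sub>V B\<^sub>W = interleaving_distance V W"
proof -
  obtain ivV CV where V: "bar_basis V B\<^sub>V ivV CV" using ex_bar_basis[OF assms(1,2,5)] by blast
  obtain ivW CW where W: "bar_basis W B\<^sub>W ivW CW" using ex_bar_basis[OF assms(3,4,6)] by blast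
  show ?thesis
  proof (rule antisym)
    show "bottleneck_distance B\<^sub>V B\<^sub>W \<le> interleaving_distance V W"
      unfolding interleaving_distance_def
    proof (rule INF_greatest)
      fix \<epsilon> assume "\<epsilon> \<in> {\<epsilon>. 0 \<le> \<epsilon> \<and> interleaved \<epsilon> V W}"
      then obtain \<gamma> where "weighted_matching B\<^sub>V B\<^sub>W \<gamma>" "matching_cost B\<^sub>V B\<^sub>W \<gamma> \<le> ennreal \<epsilon>"
        using bottleneck_le_of_interleaved[OF V W] by blast
      then show "bottleneck_distance B\<^sub>V B\<^sub>W \<le> ennreal \<epsilon>"
        unfolding bottleneck_distance_def by (intro INF_lower2[of \<gamma>]) auto
    qed
    show "interleaving_distance V W \<le> bottleneck_distance B\<^sub>V B\<^sub>W"
      unfolding bottleneck_distance_def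
    proof (rule INF_greatest)
      fix \<gamma> assume \<gamma>: "\<gamma> \<in> {\<gamma>. weighted_matching B\<^sub>V B\<^sub>W \<gamma>}"
      show "interleaving_distance V W \<le> matching_cost B\<^sub>V B\<^sub>W \<gamma>"
      proof (cases "matching_cost B\<^sub>V B\<^sub>W \<gamma>")
        case (real \<delta>)
        show ?thesis
        \<comment> \<open>Interleavings are obtained only strictly above the cost
          \<open>\<delta>\<close>, so the bound is proved up to an arbitrary
          \<open>e > 0\<close>.\<close>
        proof (rule ennreal_le_epsilon)
          fix e :: real assume e: "0 < e"
          have "interleaved (\<delta> + e) V W"
            using \<gamma> real e by (intro interleaved_of_matching[OF V W, of \<gamma> \<delta>]) auto
          then have "interleaving_distance V W \<le> ennreal (\<delta> + e)"
            unfolding interleaving_distance_def using real e by (intro INF_lower) auto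
          then show "interleaving_distance V W \<le> matching_cost B\<^sub>V B\<^sub>W \<gamma> + ennreal e"
            using real e by (simp add: ennreal_plus)
        qed
      qed simp
    qed
  qed
qed

end
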